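(* Let $s\in\mathbb{N}$, $t\in\mathbb{N}\setminus\{0\}$ and $q$ a prime power. Let $\Sigma$ be a hyperplane of $\mathrm{PG}(t,q^{s+1})$ containing a $(t-1)$-dimensional $\mathbb{F}_q$-subgeometry $\mathcal{C}$. Let $\mathcal{F}=\mathcal{F}_{t+1,s+1,q}:\mathrm{PG}(t,q^{s+1})\to\mathrm{PG}(st+s+t,q)$ be the field reduction map, let $\chi$ be an $(st-1)$-dimensional subspace of the $(st+t-1)$-space $\mathcal{F}(\Sigma)$ which intersects $\mathcal{F}(Q)$ in exactly an $(s-1)$-space for every point $Q$ of $\mathcal{C}$ (such $\chi$ exists), let $d$ be a duality of $\mathrm{PG}(st+s+t,q)$, and define, for subspaces $\tau$ of $\mathrm{PG}(t,q^{s+1})$, $\varphi(\tau):=\mathcal{F}(\tau)^d\cap\chi^d$, a subspace of the $(s+t)$-space $\chi^d$, which we identify with $\mathrm{PG}(s+t,q)$. Put $\pi:=\varphi(\Sigma)=\mathcal{F}(\Sigma)^d$, an $s$-space of $\chi^d$. Then $\varphi$ induces an isomorphism between the point-line geometry $Y(s,t,q)$ (built from $\Sigma$ and $\mathcal{C}$) and the point-line geometry $X(s,t,q)$ built in $\chi^d\cong\mathrm{PG}(s+t,q)$ with respect to the $s$-space $\pi$: the map $P\mapsto\varphi(P)$ is a bijection from the points of $Y(s,t,q)$ to the points of $X(s,t,q)$, and it maps the points of each line of $Y(s,t,q)$ onto points contained in a common line of $X(s,t,q)$.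
   Context: $\mathrm{PG}(n,q)$ is the Desarguesian projective space of projective dimension $n$ over $\mathbb{F}_q$; a $k$-space is a $k$-dimensional projective subspace. A $k$-dimensional $\mathbb{F}_q$-subgeometry of $\mathrm{PG}(n,q^{s+1})$ is a set of subspaces of $\mathrm{PG}(n,q^{s+1})$ which, with inherited incidence, is isomorphic to $\mathrm{PG}(k,q)$; it is identified with its point set when convenient. Field reduction: fix an $\mathbb{F}_q$-linear isomorphism $\mathbb{F}_{q^{s+1}}^{t+1}\cong\mathbb{F}_q^{(s+1)(t+1)}$; $\mathcal{F}_{t+1,s+1,q}$ sends the projective subspace of $\mathrm{PG}(t,q^{s+1})$ defined by an $\mathbb{F}_{q^{s+1}}$-subspace $W$ to the projective subspace of $\mathrm{PG}(st+s+t,q)$ defined by $W$ regarded as $\mathbb{F}_q$-subspace; it maps $k$-spaces to $(sk+s+k)$-spaces and is injective, preserving inclusion and disjointness. A duality $d$ is an inclusion-reversing bijection on subspaces sending $k$-spaces to $(st+s+t-1-k)$-spaces. $X(s,t,q)$ with respect to an $s$-space $\pi$ of $\mathrm{PG}(s+t,q)$: points are the $(t-1)$-spaces disjoint from $\pi$, lines are the $t$-spaces meeting $\pi$ in exactly one point, incidence is containment. $Y(s,t,q)$ with respect to $\Sigma$ and $\mathcal{C}$: points are the points of $\mathrm{PG}(t,q^{s+1})\setminus\Sigma$, lines are the point sets $\mathcal{B}\setminus\mathcal{C}$ with $\mathcal{B}$ a $t$-dimensional $\mathbb{F}_q$-subgeometry of $\mathrm{PG}(t,q^{s+1})$ containing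 $\mathcal{C}$, incidence is containment.
   Formalization: Subgeometries are taken to be those whose isomorphism with PG(k,q) is induced by a semilinear map; this is automatic for k ≥ 2 here, but for k = 1 it excludes arbitrary sets of q+1 points on a line, for which the claim fails. *)

theory Defs
  imports "HOL-Analysis.Analysis"
begin

text \<open>
  \<open>PG(n, F)\<close> is the lattice of subspaces of \<open>F ^ 'n\<close> with \<open>CARD('n) = n + 1\<close>. Projective dimensions
  are integers, one less than the vector space dimension; the empty projective space is \<open>{0}\<close>, of
  dimension \<open>-1\<close>, so two projective subspaces are disjoint iff they meet in \<open>{0}\<close>.
\<close>

definition pspace :: "int \<Rightarrow> ('a::field ^ 'n) set \<Rightarrow> bool" where
  "pspace k U \<longleftrightarrow> vec.subspace U \<and> int (vec.dim U) - 1 = k"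

definition subspaces_of :: "('a::field ^ 'n) set \<Rightarrow> ('a ^ 'n) set set" where
  "subspaces_of E = {U. vec.subspace U \<and> U \<subseteq> E}"

definition points_of :: "('a::field ^ 'n) set set \<Rightarrow> ('a ^ 'n) set set" where
  "points_of B = {P \<in> B. pspace 0 P}"

definition field_embedding :: "('a::field \<Rightarrow> 'b::field) \<Rightarrow> bool" where
  "field_embedding \<iota> \<longleftrightarrow>
     \<iota> 1 = 1 \<and> (\<forall>a b. \<iota> (a + b) = \<iota> a + \<iota> b) \<and> (\<forall>a b. \<iota> (a * b) = \<iota> a * \<iota> b)"

definition semilinear_on ::
    "('k::field \<Rightarrow> 'K::field) \<Rightarrow> ('k ^ 'n) set \<Rightarrow> ('k ^ 'n \<Rightarrow> 'K ^ 'm) \<Rightarrow> bool" where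
  "semilinear_on \<iota> E g \<longleftrightarrow>
     (\<exists>\<alpha> :: 'k \<Rightarrow> 'k. field_embedding \<alpha> \<and> bij \<alpha> \<and>
        (\<forall>x\<in>E. \<forall>y\<in>E. g (x + y) = g x + g y) \<and>
        (\<forall>c. \<forall>x\<in>E. g (c *s x) = \<iota> (\<alpha> c) *s g x))"

text \<open>
  A \<open>k\<close>-dimensional subgeometry over the subfield \<open>range \<iota>\<close>: a set \<open>B\<close> of subspaces of \<open>K ^ 'n\<close>
  which, ordered by inclusion, is isomorphic to \<open>PG(k, 'k)\<close>, realised as the subspaces of a
  \<open>k\<close>-space \<open>E\<close> of \<open>'k ^ 'n\<close>. As usual for projective spaces over fields, isomorphisms are those
  induced by semilinear maps. On a projective line this cannot be omitted: any equally large set of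
  points of a line would otherwise be a subline. For \<open>k \<ge> 2\<close> semilinearity is what the fundamental
  theorem of projective geometry provides. The isomorphism condition forces \<open>f\<close> to preserve
  dimensions.
\<close>

definition subgeometry ::
    "('k::field \<Rightarrow> 'K::field) \<Rightarrow> int \<Rightarrow> ('K ^ 'n) set set \<Rightarrow> bool" where
  "subgeometry \<iota> k B \<longleftrightarrow>
     (\<exists>(E :: ('k ^ 'n) set) f.
        pspace k E \<and>
        bij_betw f (subspaces_of E) B \<and>
        (\<forall>U\<in>subspaces_of E. \<forall>W\<in>subspaces_of E. U \<subseteq> W \<longleftrightarrow> f U \<subseteq> f W) \<and>
        (\<exists>g. semilinear_on \<iota> E g \<and> (\<forall>W\<in>subspaces_of E. f W = vec.span (g ` W))))"

definition linear_iso_over ::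
    "('k::field \<Rightarrow> 'K::field) \<Rightarrow> ('K ^ 'n \<Rightarrow> 'k ^ 'm) \<Rightarrow> bool" where
  "linear_iso_over \<iota> \<psi> \<longleftrightarrow>
     Vector_Spaces.linear (\<lambda>c v. \<iota> c *s v) (*s) \<psi> \<and> bij \<psi>"

definition field_reduction :: "('K ^ 'n \<Rightarrow> 'k ^ 'm) \<Rightarrow> ('K ^ 'n) set \<Rightarrow> ('k ^ 'm) set" where
  "field_reduction \<psi> W = \<psi> ` W"

definition duality :: "int \<Rightarrow> (('a::field ^ 'm) set \<Rightarrow> ('a ^ 'm) set) \<Rightarrow> bool" where
  "duality N d \<longleftrightarrow>
     bij_betw d {U. vec.subspace U} {U. vec.subspace U} \<and>
     (\<forall>U W. vec.subspace U \<longrightarrow> vec.subspace W \<longrightarrow> U \<subseteq> W \<longrightarrow> d W \<subseteq> d U) \<and>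
     (\<forall>k U. pspace k U \<longrightarrow> pspace (N - 1 - k) (d U))"

text \<open>The geometry \<open>X(s,t,q)\<close> inside an \<open>(s+t)\<close>-space \<open>A\<close>, with respect to an \<open>s\<close>-space \<open>\<pi>\<close> of \<open>A\<close>.\<close>

definition X_points :: "nat \<Rightarrow> ('a::field ^ 'm) set \<Rightarrow> ('a ^ 'm) set \<Rightarrow> ('a ^ 'm) set set" where
  "X_points t A \<pi> = {\<tau>. pspace (int t - 1) \<tau> \<and> \<tau> \<subseteq> A \<and> \<tau> \<inter> \<pi> = {0}}"

definition X_lines :: "nat \<Rightarrow> ('a::field ^ 'm) set \<Rightarrow> ('a ^ 'm) set \<Rightarrow> ('a ^ 'm) set set" where
  "X_lines t A \<pi> = {\<tau>. pspace (int t) \<tau> \<and> \<tau> \<subseteq> A \<and> pspace 0 (\<tau> \<inter> \<pi>)}"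

definition Y_points :: "('K::field ^ 'n) set \<Rightarrow> ('K ^ 'n) set set" where
  "Y_points \<Sigma> = {P. pspace 0 P \<and> \<not> P \<subseteq> \<Sigma>}"

definition Y_lines ::
    "('k::field \<Rightarrow> 'K::field) \<Rightarrow> nat \<Rightarrow> ('K ^ 'n) set set \<Rightarrow> ('K ^ 'n) set set set" where
  "Y_lines \<iota> t C =
     {points_of B - points_of C | B. subgeometry \<iota> (int t) B \<and> points_of C \<subseteq> points_of B}"

definition geometry_iso ::
    "('p \<Rightarrow> 'r) \<Rightarrow> 'p set \<Rightarrow> 'l set \<Rightarrow> ('p \<Rightarrow> 'l \<Rightarrow> bool)
       \<Rightarrow> 'r set \<Rightarrow> 'm set \<Rightarrow> ('r \<Rightarrow> 'm \<Rightarrow> bool) \<Rightarrow> bool" where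
  "geometry_iso f P L I P' L' I' \<longleftrightarrow>
     bij_betw f P P' \<and>
     (\<exists>g. bij_betw g L L' \<and> (\<forall>p\<in>P. \<forall>l\<in>L. I p l \<longleftrightarrow> I' (f p) (g l)))"

definition admissible_chi ::
    "nat \<Rightarrow> nat \<Rightarrow> ('K::field ^ 'n \<Rightarrow> 'k::field ^ 'm) \<Rightarrow> ('K ^ 'n) set \<Rightarrow> ('K ^ 'n) set set
       \<Rightarrow> ('k ^ 'm) set \<Rightarrow> bool" where
  "admissible_chi s t \<psi> \<Sigma> C chi \<longleftrightarrow>
     pspace (int s * int t - 1) chi \<and>
     chi \<subseteq> field_reduction \<psi> \<Sigma> \<and>
     (\<forall>Q\<in>points_of C. pspace (int s - 1) (chi \<inter> field_reduction \<psi> Q))"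

definition phi ::
    "('K ^ 'n \<Rightarrow> 'k ^ 'm) \<Rightarrow> (('k ^ 'm) set \<Rightarrow> ('k ^ 'm) set) \<Rightarrow> ('k ^ 'm) set
       \<Rightarrow> ('K ^ 'n) set \<Rightarrow> ('k ^ 'm) set" where
  "phi \<psi> d chi \<tau> = d (field_reduction \<psi> \<tau>) \<inter> d chi"

end

theory Submission
  imports Defs
begin

text \<open>
  Choose coordinates in which \<open>\<Sigma>\<close> is the hyperplane \<open>x $ i0 = 0\<close> and the points of \<open>C\<close> are
  spanned by the vectors of \<open>\<Sigma>\<close> with entries in the subfield \<open>k\<close>. The points off \<open>\<Sigma>\<close> are then
  \<open>K(e + x)\<close> with \<open>e\<close> the \<open>i0\<close>-th unit vector and \<open>x \<in> \<Sigma>\<close>, and the lines of \<open>Y\<close> are the cosets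
  \<open>x + c k^t\<close>, \<open>c \<noteq> 0\<close>: a subgeometry \<open>B\<close> through \<open>C\<close> is, up to a scalar, the \<open>k\<close>-span of the
  \<open>k\<close>-rational vectors of \<open>\<Sigma>\<close> and one vector off \<open>\<Sigma>\<close>.

  A linear space of maps of rank one has a common kernel or a common image; hence every admissible
  \<open>chi\<close> is \<open>H^t\<close> for a single \<open>k\<close>-hyperplane \<open>H = ker f\<close> of \<open>K\<close>. Since \<open>(a, b) \<mapsto> f (a b)\<close> is a
  nondegenerate form, every \<open>k\<close>-linear map from \<open>K\<close> to \<open>k\<close> is \<open>a \<mapsto> f (a b)\<close> for a unique \<open>b\<close>.

  A duality of a finite projective space is an anti-automorphism of the subspace lattice, so
  \<open>\<phi>(\<tau>)\<close> is dual to \<open>\<tau> + chi\<close>. Dually, points of \<open>X\<close> are the complements of \<open>\<Sigma> / chi\<close>, i.e. graphs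
  of linear maps \<open>K \<rightarrow> k^t\<close>, which have the form \<open>a \<mapsto> (f (a x_i))_i\<close>; lines of \<open>X\<close> are the
  restrictions of such maps to hyperplanes \<open>{a. f (c a) = 0}\<close>. Such a restriction determines \<open>x\<close>
  exactly up to \<open>c k^t\<close>, which matches the lines of \<open>Y\<close>.
\<close>

section \<open>Finite vector spaces\<close>

definition ssum :: "'a::ab_group_add set \<Rightarrow> 'a set \<Rightarrow> 'a set" where
  "ssum A B = {x + y | x y. x \<in> A \<and> y \<in> B}"

text \<open>The scalar multiplication stays arbitrary because three structures are covered:
  \<open>'a ^ 'n\<close> over \<open>'a\<close> and, with scalars restricted along an embedding of
  \<open>'k\<close> into \<open>'K\<close>, both \<open>'K\<close> and \<open>'K ^ 'n\<close> over
  \<open>'k\<close>.\<close>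

locale finite_vector_space = vector_space scale
  for scale :: "'a::{field,finite} \<Rightarrow> 'b::{ab_group_add,finite} \<Rightarrow> 'b"
begin

text \<open>Coefficient functions on \<open>B\<close>, made extensional so that only their values on
  \<open>B\<close> count, correspond one to one to the vectors of the span. Independence gives
  injectivity.\<close>

lemma card_span_independent:
  assumes "independent B"
  shows "card (span B) = CARD('a) ^ card B"
proof -
  have fB: "finite B" by simp
  let ?h = "\<lambda>u. \<Sum>v\<in>B. scale (u v) v"
  have inj: "inj_on ?h (B \<rightarrow>\<^sub>E UNIV)"
  proof (rule inj_onI)
    fix u u' assume u: "u \<in> B \<rightarrow>\<^sub>E UNIV" "u' \<in> B \<rightarrow>\<^sub>E UNIV" and eq: "?h u = ?h u'"
    have "(\<Sum>v\<in>B. scale (u v - u' v) v) = 0"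
      using eq by (simp add: scale_left_diff_distrib sum_subtractf)
    then have "u v - u' v = 0" if "v \<in> B" for v
      using independentD[OF assms fB subset_refl _ that, of "\<lambda>v. u v - u' v"] by simp
    then show "u = u'"
      using u by (intro PiE_ext[OF u]) auto
  qed
  have img: "?h ` (B \<rightarrow>\<^sub>E UNIV) = span B"
  proof -
    have "?h u \<in> ?h ` (B \<rightarrow>\<^sub>E UNIV)" for u
      by (rule image_eqI[where x = "restrict u B"]) auto
    then show ?thesis
      unfolding span_finite[OF fB] by blast
  qed
  show ?thesis
    using card_image[OF inj] unfolding img by (simp add: card_PiE[OF fB])
qed

lemma card_subspace:
  assumes "subspace U"
  shows "card U = CARD('a) ^ dim U"
proof -
  obtain B where B: "B \<subseteq> U" "independent B" "U \<subseteq> span B" "card B = dim U"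
    using basis_exists by blast
  then have "span B = U"
    using assms by (metis span_subspace)
  then show ?thesis
    using card_span_independent[OF B(2)] B(4) by simp
qed

lemma card_scalars_gt_1: "1 < CARD('a)"
  using card_mono[of "UNIV :: 'a set" "{0, 1}"] by simp

text \<open>Dimensions are integers, so a proper inclusion raises the dimension by at least one and
  the cardinality by at least a factor \<open>CARD('a)\<close>.\<close>

lemma card_subspace_psubset:
  assumes "subspace A" "subspace B" "A \<subset> B"
  shows "CARD('a) * card A \<le> card B"
proof -
  have "CARD('a) ^ dim A < CARD('a) ^ dim B"
    using psubset_card_mono[OF _ assms(3)] card_subspace assms by simp
  then have "dim A < dim B"
    using card_scalars_gt_1 power_less_imp_less_exp by blast
  then have "CARD('a) ^ Suc (dim A) \<le> CARD('a) ^ dim B"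
    using card_scalars_gt_1 by (intro power_increasing) auto
  then show ?thesis
    using card_subspace assms by simp
qed

lemma subspace_ssum: "subspace A \<Longrightarrow> subspace B \<Longrightarrow> subspace (ssum A B)"
  unfolding ssum_def by (rule subspace_sums)

lemma ssum_superset:
  assumes "subspace A" "subspace B"
  shows "A \<subseteq> ssum A B" "B \<subseteq> ssum A B"
  unfolding ssum_def using subspace_0[OF assms(1)] subspace_0[OF assms(2)]
  by (force intro: exI[of _ 0])+

lemma ssum_least:
  assumes "subspace W" "A \<subseteq> W" "B \<subseteq> W"
  shows "ssum A B \<subseteq> W"
  unfolding ssum_def using assms by (auto intro!: subspace_add)

text \<open>This is the dimension formula in multiplicative form. Every fibre of addition from
  \<open>A \<times> B\<close> onto the sum is a translate of the pairs \<open>(w, - w)\<close> with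
  \<open>w\<close> in \<open>A \<inter> B\<close>.\<close>

lemma card_ssum:
  assumes A: "subspace A" and B: "subspace B"
  shows "card (ssum A B) * card (A \<inter> B) = card A * card B"
proof -
  let ?S = "ssum A B"
  let ?h = "\<lambda>p::'b \<times> 'b. fst p + snd p"
  have fib: "card {p \<in> A \<times> B. ?h p = z} = card (A \<inter> B)" if z: "z \<in> ?S" for z
  proof -
    obtain x y where xy: "z = x + y" "x \<in> A" "y \<in> B" using z unfolding ssum_def by blast
    have "bij_betw (\<lambda>w. (x + w, y - w)) (A \<inter> B) {p \<in> A \<times> B. ?h p = z}"
    proof (rule bij_betw_byWitness[where f' = "\<lambda>p. fst p - x"])
      show "(\<lambda>w. (x + w, y - w)) ` (A \<inter> B) \<subseteq> {p \<in> A \<times> B. ?h p = z}"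
        using xy A B by (simp add: image_subset_iff subspace_add subspace_diff)
      show "(\<lambda>p. fst p - x) ` {p \<in> A \<times> B. ?h p = z} \<subseteq> A \<inter> B"
      proof (rule image_subsetI)
        fix p assume p: "p \<in> {p \<in> A \<times> B. ?h p = z}"
        then have "fst p - x = y - snd p" using xy(1) by (simp add: algebra_simps)
        then show "fst p - x \<in> A \<inter> B"
          using p xy A B subspace_diff[of A "fst p" x] subspace_diff[of B y "snd p"] by auto
      qed
      show "\<forall>p\<in>{p \<in> A \<times> B. ?h p = z}. (x + (fst p - x), y - (fst p - x)) = p"
      proof
        fix p assume "p \<in> {p \<in> A \<times> B. ?h p = z}"
        then have "y - (fst p - x) = snd p" using xy(1) by (simp add: algebra_simps)
        then show "(x + (fst p - x), y - (fst p - x)) = p" by (simp add: prod_eq_iff)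
      qed
    qed simp
    then show ?thesis by (simp add: bij_betw_same_card)
  qed
  have "card (A \<times> B) = (\<Sum>z\<in>?h ` (A \<times> B). card {p \<in> A \<times> B. ?h p = z})"
    using sum.image_gen[of "A \<times> B" "\<lambda>_. 1::nat" ?h] by simp
  also have "?h ` (A \<times> B) = ?S" unfolding ssum_def by force
  also have "(\<Sum>z\<in>?S. card {p \<in> A \<times> B. ?h p = z}) = (\<Sum>z\<in>?S. card (A \<inter> B))"
    by (intro sum.cong refl fib)
  also have "\<dots> = card ?S * card (A \<inter> B)"
    by simp
  finally show ?thesis by (simp add: card_cartesian_product)
qed

text \<open>\<open>Z\<close> becomes a hyperplane of \<open>U\<close> and the kernel of a
  functional, the coefficient of \<open>u\<close>. That coefficient is unique because
  \<open>u\<close> lies outside \<open>Z\<close>. In this way subspaces of codimension one are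
  turned into functionals.\<close>

lemma subspace_insert_functional:
  assumes Z: "subspace Z" and u: "u \<notin> Z"
  defines "U \<equiv> {z + scale r u | z r. z \<in> Z}"
  shows "subspace U" and "card U = CARD('a) * card Z"
    and "\<exists>g. (\<forall>v\<in>U. \<forall>w\<in>U. g (v + w) = g v + g w) \<and> (\<forall>c. \<forall>v\<in>U. g (scale c v) = c * g v) \<and>
      (\<forall>v\<in>U. g v = 0 \<longleftrightarrow> v \<in> Z) \<and> g u = 1"
proof -
  have uniq: "r = r'" if "v - scale r u \<in> Z" "v - scale r' u \<in> Z" for v r r'
  proof (rule ccontr)
    assume ne: "r \<noteq> r'"
    have "(v - scale r u) - (v - scale r' u) \<in> Z" using Z that by (rule subspace_diff)
    then have "scale (r' - r) u \<in> Z" by (simp add: scale_left_diff_distrib)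
    then have "scale (inverse (r' - r)) (scale (r' - r) u) \<in> Z" by (rule subspace_scale[OF Z])
    then show False using u ne by simp
  qed
  have U: "v \<in> U \<longleftrightarrow> (\<exists>r. v - scale r u \<in> Z)" for v
  proof
    assume "v \<in> U"
    then obtain z r where "z \<in> Z" "v = z + scale r u" unfolding U_def by blast
    then show "\<exists>r. v - scale r u \<in> Z" by (intro exI[of _ r]) simp
  next
    assume "\<exists>r. v - scale r u \<in> Z"
    then obtain r where "v - scale r u \<in> Z" by blast
    then show "v \<in> U" unfolding U_def by (intro CollectI exI[of _ "v - scale r u"] exI[of _ r]) simp
  qed
  have add: "(v + w) - scale (r + r') u \<in> Z" if "v - scale r u \<in> Z" "w - scale r' u \<in> Z" for v w r r'
    using subspace_add[OF Z that] by (simp add: scale_left_distrib algebra_simps)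
  have sc: "scale c v - scale (c * r) u \<in> Z" if "v - scale r u \<in> Z" for c v r
    using subspace_scale[OF Z that, of c] by (simp add: scale_right_diff_distrib)
  show "subspace U"
  proof (rule subspaceI)
    show "0 \<in> U" unfolding U by (rule exI[of _ 0]) (simp add: subspace_0[OF Z])
    show "v + w \<in> U" if "v \<in> U" "w \<in> U" for v w
      using that add unfolding U by blast
    show "scale c v \<in> U" if "v \<in> U" for c v
      using that sc unfolding U by blast
  qed
  have inj: "inj_on (\<lambda>p. fst p + scale (snd p) u) (Z \<times> UNIV)"
  proof (rule inj_onI)
    fix p p' assume p: "p \<in> Z \<times> UNIV" "p' \<in> Z \<times> UNIV"
      and eq: "fst p + scale (snd p) u = fst p' + scale (snd p') u"
    have "fst p + scale (snd p) u - scale (snd p) u \<in> Z" using p by auto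
    moreover have "fst p + scale (snd p) u - scale (snd p') u \<in> Z" unfolding eq using p by auto
    ultimately have "snd p = snd p'" by (rule uniq)
    then show "p = p'" using eq by (simp add: prod_eq_iff)
  qed
  have "(\<lambda>p. fst p + scale (snd p) u) ` (Z \<times> UNIV) = U" unfolding U_def by force
  then have "card U = card (Z \<times> (UNIV :: 'a set))" using card_image[OF inj] by simp
  then show "card U = CARD('a) * card Z" by (simp add: card_cartesian_product)
  define g where "g v = (THE r. v - scale r u \<in> Z)" for v
  have g: "g v = r" if "v - scale r u \<in> Z" for v r
    unfolding g_def using that uniq by blast
  have gU: "v - scale (g v) u \<in> Z" if "v \<in> U" for v
    using that g unfolding U by metis
  show "\<exists>g. (\<forall>v\<in>U. \<forall>w\<in>U. g (v + w) = g v + g w) \<and> (\<forall>c. \<forall>v\<in>U. g (scale c v) = c * g v) \<and>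
      (\<forall>v\<in>U. g v = 0 \<longleftrightarrow> v \<in> Z) \<and> g u = 1"
  proof (intro exI[of _ g] conjI ballI allI)
    show "g (v + w) = g v + g w" if "v \<in> U" "w \<in> U" for v w
      using that gU by (intro g add)
    show "g (scale c v) = c * g v" if "v \<in> U" for c v
      using that gU by (intro g sc)
    show "g v = 0 \<longleftrightarrow> v \<in> Z" if "v \<in> U" for v
      using gU[OF that] g[of v 0] by auto
    show "g u = 1" by (rule g) (simp add: subspace_0[OF Z])
  qed
qed

end

interpretation vec: finite_vector_space "(*s) :: 'a::{field,finite} \<Rightarrow> 'a ^ 'n \<Rightarrow> 'a ^ 'n"
  by unfold_locales

text \<open>Allows projective dimensions to be checked by counting. \<open>j\<close> is the vector
  space dimension, so the empty space with \<open>k = -1\<close> is the case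
  \<open>j = 0\<close>.\<close>

lemma pspace_iff_card:
  fixes U :: "('a::{field,finite} ^ 'n) set"
  assumes "int j = k + 1"
  shows "pspace k U \<longleftrightarrow> vec.subspace U \<and> card U = CARD('a) ^ j"
proof -
  have "CARD('a) ^ vec.dim U = CARD('a) ^ j \<longleftrightarrow> int (vec.dim U) = int j"
    using vec.card_scalars_gt_1[where 'a = 'a] power_inject_exp[of "CARD('a)"] by simp
  moreover have "int (vec.dim U) - 1 = k \<longleftrightarrow> int (vec.dim U) = int j"
    using assms by linarith
  ultimately show ?thesis
    unfolding pspace_def by (metis vec.card_subspace)
qed

section \<open>Subgeometries\<close>

lemma span_scale_singleton:
  fixes v :: "'a::field ^ 'n"
  assumes "c \<noteq> 0"
  shows "vec.span {c *s v} = vec.span {v}"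
proof (rule antisym)
  show "vec.span {c *s v} \<subseteq> vec.span {v}"
    by (rule vec.span_minimal) (simp_all add: vec.span_base vec.span_scale)
  have "inverse c *s (c *s v) \<in> vec.span {c *s v}"
    by (intro vec.span_scale vec.span_base) simp
  then show "vec.span {v} \<subseteq> vec.span {c *s v}"
    using assms by (intro vec.span_minimal) simp_all
qed

lemma pspace_0_iff:
  fixes P :: "('a::field ^ 'n) set"
  shows "pspace 0 P \<longleftrightarrow> (\<exists>v. v \<noteq> 0 \<and> P = vec.span {v})"
proof
  assume P: "pspace 0 P"
  then have sub: "vec.subspace P" and dim: "vec.dim P = 1" by (auto simp: pspace_def)
  obtain B where B: "B \<subseteq> P" "vec.independent B" "P \<subseteq> vec.span B" "card B = 1"
    using vec.basis_exists[of P] dim by metis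
  obtain v where v: "B = {v}" using B(4) by (auto simp: card_1_singleton_iff)
  then have "v \<noteq> 0" using B(2) vec.dependent_zero by blast
  moreover have "P = vec.span {v}"
    using B sub v by (metis vec.span_subspace)
  ultimately show "\<exists>v. v \<noteq> 0 \<and> P = vec.span {v}" by blast
next
  assume "\<exists>v. v \<noteq> 0 \<and> P = vec.span {v}"
  then obtain v where v: "v \<noteq> 0" "P = vec.span {v}" by blast
  then have "vec.dim P = 1"
    using vec.dim_span_eq_card_independent[of "{v}"] by simp
  then show "pspace 0 P" using v by (simp add: pspace_def)
qed

lemma pspace_0_eq_span:
  fixes P :: "('a::field ^ 'n) set"
  assumes "pspace 0 P" "v \<in> P" "v \<noteq> 0"
  shows "P = vec.span {v}"
proof -
  obtain u where u: "P = vec.span {u}" using assms(1) pspace_0_iff by blast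
  then obtain c where "v = c *s u" using assms(2) by (auto simp: vec.span_singleton)
  then show ?thesis using u assms(3) span_scale_singleton[of c u] by auto
qed

section \<open>Rational vectors, i.e. those with entries in the subfield, and linear
  combinations\<close>

definition emb :: "('k::field \<Rightarrow> 'K::field) \<Rightarrow> 'k ^ 'n \<Rightarrow> 'K ^ 'n" where
  "emb \<iota> x = (\<chi> i. \<iota> (x $ i))"

definition comb :: "('n::finite \<Rightarrow> 'a::field ^ 'm) \<Rightarrow> 'a ^ 'n \<Rightarrow> 'a ^ 'm" where
  "comb b x = (\<Sum>i\<in>UNIV. x $ i *s b i)"

lemma emb_nth [simp]: "emb \<iota> x $ i = \<iota> (x $ i)"
  by (simp add: emb_def)

lemma linear_comb: "Vector_Spaces.linear (*s) (*s) (comb b)"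
  by (rule Vector_Spaces.linear.intro)
    (unfold_locales, auto simp: comb_def vec.scale_left_distrib sum.distrib vec.scale_sum_right)

lemma comb_axis [simp]: "comb b (axis i 1) = b i"
proof -
  have "comb b (axis i 1) = (\<Sum>j\<in>UNIV. if j = i then b j else 0)"
    unfolding comb_def by (rule sum.cong) (auto simp: axis_def)
  then show ?thesis by simp
qed

lemma bij_comb:
  fixes b :: "'n::finite \<Rightarrow> 'a::{field,finite} ^ 'n"
  assumes "inj b" "vec.independent (range b)"
  shows "bij (comb b)"
proof -
  have "card (range b) = vec.dim (UNIV :: ('a ^ 'n) set)"
    using assms(1) by (simp add: card_image card_cart_basis)
  then have "UNIV \<subseteq> vec.span (range b)"
    using vec.card_eq_dim[of "range b" UNIV] assms(2) by simp
  moreover have "vec.span (range b) \<subseteq> range (comb b)"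
  proof (rule vec.span_minimal)
    show "range b \<subseteq> range (comb b)"
      using comb_axis[of b] by (metis image_subsetI rangeI)
    show "vec.subspace (range (comb b))"
      using vec.linear_subspace_image[OF linear_comb vec.subspace_UNIV] .
  qed
  ultimately have "surj (comb b)" by blast
  then show ?thesis
    using finite_UNIV_surj_inj[of "comb b"] by (simp add: bij_def)
qed

locale field_emb =
  fixes \<iota> :: "'k::{field,finite} \<Rightarrow> 'K::{field,finite}"
  assumes emb: "field_embedding \<iota>"
begin

lemma iota_1 [simp]: "\<iota> 1 = 1"
  and iota_add: "\<iota> (a + b) = \<iota> a + \<iota> b"
  and iota_mult: "\<iota> (a * b) = \<iota> a * \<iota> b"
  using emb by (auto simp: field_embedding_def)

lemma iota_0 [simp]: "\<iota> 0 = 0"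
  using iota_add[of 0 0] by (metis add.right_neutral add_left_cancel)

lemma iota_eq_0_iff [simp]: "\<iota> a = 0 \<longleftrightarrow> a = 0"
proof
  assume "\<iota> a = 0"
  then have "\<iota> (a * inverse a) = 0" by (simp add: iota_mult)
  then show "a = 0" by (metis iota_1 right_inverse zero_neq_one)
qed simp

lemma iota_diff: "\<iota> (a - b) = \<iota> a - \<iota> b"
  using iota_add[of "a - b" b] by simp

lemma iota_eq_iff [simp]: "\<iota> a = \<iota> b \<longleftrightarrow> a = b"
  using iota_eq_0_iff[of "a - b"] by (simp add: iota_diff del: iota_eq_0_iff)

lemma emb_0 [simp]: "emb \<iota> 0 = 0"
  and emb_add: "emb \<iota> (x + y) = emb \<iota> x + emb \<iota> y"
  and emb_scale: "emb \<iota> (c *s x) = \<iota> c *s emb \<iota> x"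
  and emb_eq_iff [simp]: "emb \<iota> x = emb \<iota> y \<longleftrightarrow> x = y"
  and emb_axis [simp]: "emb \<iota> (axis i 1) = axis i 1"
  by (auto simp: vec_eq_iff iota_add iota_mult axis_def)

lemma emb_eq_0_iff [simp]: "emb \<iota> x = 0 \<longleftrightarrow> x = 0"
  using emb_eq_iff[of x 0] by (simp del: emb_eq_iff)

text \<open>The vectors of \<open>E\<close> whose image lies in the \<open>'K\<close>-span form a
  \<open>'k\<close>-subspace, because the twisted scalars \<open>\<iota> (\<alpha> c)\<close> are
  still scalars of \<open>'K\<close>.\<close>

lemma semilinear_on_span:
  fixes g :: "'k ^ 'n \<Rightarrow> 'K ^ 'm"
  assumes "semilinear_on \<iota> E g" "vec.subspace E" "X \<subseteq> E"
  shows "g ` vec.span X \<subseteq> vec.span (g ` X)"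
proof -
  obtain \<alpha> where g: "\<And>x y. x \<in> E \<Longrightarrow> y \<in> E \<Longrightarrow> g (x + y) = g x + g y"
      "\<And>c x. x \<in> E \<Longrightarrow> g (c *s x) = \<iota> (\<alpha> c) *s g x" "field_embedding \<alpha>"
    using assms(1) unfolding semilinear_on_def by blast
  have g0: "g 0 = 0" using g(1)[of 0 0] vec.subspace_0[OF assms(2)] by simp
  have "vec.subspace {x \<in> E. g x \<in> vec.span (g ` X)}"
    by (rule vec.subspaceI)
      (use g g0 assms(2) in \<open>auto simp: vec.span_zero vec.span_add vec.span_scale
        vec.subspace_0 vec.subspace_add vec.subspace_scale\<close>)
  moreover have "X \<subseteq> {x \<in> E. g x \<in> vec.span (g ` X)}"
    using assms(3) by (auto intro: vec.span_base)
  ultimately have "vec.span X \<subseteq> {x \<in> E. g x \<in> vec.span (g ` X)}"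
    by (intro vec.span_minimal)
  then show ?thesis by auto
qed

lemma semilinear_on_emb:
  fixes T :: "'K ^ 'n \<Rightarrow> 'K ^ 'm"
  assumes "Vector_Spaces.linear (*s) (*s) T"
  shows "semilinear_on \<iota> E (\<lambda>w. T (emb \<iota> w))"
  unfolding semilinear_on_def
  by (rule exI[of _ id])
    (simp add: field_embedding_def emb_add emb_scale vec.linear_add[OF assms] vec.linear_scale[OF assms])

text \<open>Extension of scalars creates no new rational vectors. If \<open>w\<close> were outside
  \<open>W\<close>, a basis of \<open>W\<close> together with \<open>w\<close> would extend to a
  basis \<open>Z\<close> of \<open>'k ^ 'n\<close>. The image of \<open>Z\<close> spans
  \<open>'K ^ 'n\<close>, since it spans the unit vectors, and has \<open>CARD('n)\<close> elements,
  so it is independent over \<open>'K\<close>; then \<open>w\<close> cannot be in the span of the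
  rest.\<close>

lemma emb_in_spanD:
  fixes W :: "('k ^ 'n) set"
  assumes "vec.subspace W" "emb \<iota> w \<in> vec.span (emb \<iota> ` W)"
  shows "w \<in> W"
proof (rule ccontr)
  assume w: "w \<notin> W"
  have sl: "semilinear_on \<iota> UNIV (emb \<iota> :: 'k ^ 'n \<Rightarrow> 'K ^ 'n)"
    by (rule semilinear_on_emb[of "\<lambda>x. x", OF vec.linear_ident])
  obtain Y where Y: "Y \<subseteq> W" "vec.independent Y" "W \<subseteq> vec.span Y"
    using vec.basis_exists[of W] by metis
  have spY: "vec.span Y = W" using Y assms(1) by (metis vec.span_subspace)
  have ins: "vec.independent (insert w Y)"
    using Y(2) w spY by (simp add: vec.independent_insertI)
  define Z where "Z = vec.extend_basis (insert w Y)"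
  have Z: "insert w Y \<subseteq> Z" "vec.independent Z" "vec.span Z = UNIV"
    unfolding Z_def using vec.extend_basis_superset[OF ins] vec.independent_extend_basis[OF ins]
      vec.span_extend_basis[OF ins] by auto
  have inj: "inj_on (emb \<iota>) A" for A :: "('k ^ 'n) set" by (rule inj_onI) simp
  have "card Z = CARD('n)"
    using vec.dim_eq_card[of Z UNIV] Z by (simp add: card_cart_basis)
  then have card: "card (emb \<iota> ` Z) = vec.dim (UNIV :: ('K ^ 'n) set)"
    by (simp add: card_image[OF inj] card_cart_basis)
  have "axis i (1::'K) \<in> vec.span (emb \<iota> ` Z)" for i
    using semilinear_on_span[OF sl vec.subspace_UNIV, of Z] Z(3) emb_axis[of i]
    by (metis UNIV_I image_subset_iff subset_UNIV)
  then have "comb (\<lambda>i. axis i (1::'K)) x \<in> vec.span (emb \<iota> ` Z)" for x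
    unfolding comb_def by (intro vec.span_sum vec.span_scale)
  moreover have "comb (\<lambda>i. axis i (1::'K)) x = x" for x
    unfolding comb_def by (rule basis_expansion)
  ultimately have "UNIV \<subseteq> vec.span (emb \<iota> ` Z)" by (metis subsetI)
  then have indep: "vec.independent (emb \<iota> ` Z)"
    using vec.card_eq_dim[of "emb \<iota> ` Z" UNIV] card by simp
  have "vec.span (emb \<iota> ` W) \<subseteq> vec.span (emb \<iota> ` Y)"
    using semilinear_on_span[OF sl vec.subspace_UNIV, of Y] spY
    by (intro vec.span_minimal) auto
  moreover have "w \<notin> Y" using w Y(1) by blast
  then have "emb \<iota> ` Y \<subseteq> emb \<iota> ` Z - {emb \<iota> w}" using Z(1) by auto
  ultimately have "emb \<iota> w \<in> vec.span (emb \<iota> ` Z - {emb \<iota> w})"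
    using assms(2) vec.span_mono by blast
  then show False
    using indep Z(1) unfolding vec.dependent_def by blast
qed

text \<open>\<open>f\<close> maps the span of \<open>X\<close> to the span of \<open>g\<close>
  X\<open>. As\<close>f\<open>reflects inclusion,\<close>g w\<open>in the span of\<close>g
  \<open>X\<close> forces \<open>w\<close> into the span of \<open>X\<close>. So nonzero vectors go
  to nonzero vectors, and independence over \<open>'k\<close> becomes independence over
  \<open>'K\<close>.\<close>

lemma subgeometry_points:
  fixes g :: "'k ^ 'n \<Rightarrow> 'K ^ 'n"
  assumes E: "vec.subspace E" and bij: "bij_betw f (subspaces_of E) B"
    and ord': "\<forall>U\<in>subspaces_of E. \<forall>W\<in>subspaces_of E. U \<subseteq> W \<longleftrightarrow> f U \<subseteq> f W"
    and sl: "semilinear_on \<iota> E g" and f': "\<forall>W\<in>subspaces_of E. f W = vec.span (g ` W)"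
  shows "points_of B = {vec.span {g w} | w. w \<in> E \<and> w \<noteq> 0}"
    and "X \<subseteq> E \<Longrightarrow> vec.independent X \<Longrightarrow> vec.independent (g ` X) \<and> inj_on g X"
proof -
  note ord = ord'[rule_format] and f = f'[rule_format]
  have g0: "g 0 = 0"
    using sl vec.subspace_0[OF E] unfolding semilinear_on_def by (metis add_cancel_left_left)
  have spanE: "vec.span X \<in> subspaces_of E" if "X \<subseteq> E" for X
    using that E by (simp add: subspaces_of_def vec.span_minimal)
  have fspan: "f (vec.span X) = vec.span (g ` X)" if X: "X \<subseteq> E" for X
  proof -
    have "vec.span (g ` vec.span X) = vec.span (g ` X)"
    proof (rule antisym)
      show "vec.span (g ` vec.span X) \<subseteq> vec.span (g ` X)"
        using semilinear_on_span[OF sl E X] by (intro vec.span_minimal) auto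
      show "vec.span (g ` X) \<subseteq> vec.span (g ` vec.span X)"
        by (intro vec.span_mono image_mono vec.span_superset)
    qed
    then show ?thesis using f[OF spanE[OF X]] by simp
  qed
  have gin: "w \<in> vec.span X" if "g w \<in> vec.span (g ` X)" "w \<in> E" "X \<subseteq> E" for w X
  proof -
    have "f (vec.span {w}) \<subseteq> f (vec.span X)"
      using that fspan[of "{w}"] fspan[of X] by (simp add: vec.span_minimal)
    then have "vec.span {w} \<subseteq> vec.span X"
      using ord[OF spanE spanE, of "{w}" X] that by simp
    then show ?thesis using vec.span_base by blast
  qed
  \<comment> \<open>The empty set has span \<open>{0}\<close>, so \<open>g w = 0\<close> would force
    \<open>w = 0\<close>.\<close>
  have gne: "g w \<noteq> 0" if "w \<in> E" "w \<noteq> 0" for w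
    using gin[of w "{}"] that by auto
  show "points_of B = {vec.span {g w} | w. w \<in> E \<and> w \<noteq> 0}"
  proof (intro antisym subsetI)
    fix P assume "P \<in> points_of B"
    then have PB: "P \<in> B" and P: "pspace 0 P" by (auto simp: points_of_def)
    obtain W where W: "W \<in> subspaces_of E" "P = f W"
      using PB bij by (auto simp: bij_betw_def)
    have Wsub: "vec.subspace W" "W \<subseteq> E" using W(1) by (auto simp: subspaces_of_def)
    have "W \<noteq> {0}"
    proof
      assume "W = {0}"
      then have "P = {0}" using W f[OF W(1)] g0 by simp
      then show False using P by (simp add: pspace_def)
    qed
    then obtain w where w: "w \<in> W" "w \<noteq> 0" using vec.subspace_0[OF Wsub(1)] by blast
    have "g w \<in> P" using W f[OF W(1)] w by (auto intro: vec.span_base)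
    then have "P = vec.span {g w}" using pspace_0_eq_span[OF P] gne w Wsub by blast
    then show "P \<in> {vec.span {g w} | w. w \<in> E \<and> w \<noteq> 0}" using w Wsub by blast
  next
    fix P assume "P \<in> {vec.span {g w} | w. w \<in> E \<and> w \<noteq> 0}"
    then obtain w where w: "w \<in> E" "w \<noteq> 0" "P = vec.span {g w}" by blast
    then have "P = f (vec.span {w})" using fspan[of "{w}"] by simp
    then have "P \<in> B" using spanE[of "{w}"] w(1) bij by (auto simp: bij_betw_def)
    moreover have "pspace 0 P" using w gne pspace_0_iff by blast
    ultimately show "P \<in> points_of B" by (simp add: points_of_def)
  qed
  show "vec.independent (g ` X) \<and> inj_on g X" if X: "X \<subseteq> E" "vec.independent X"
  proof
    have main: "g x \<notin> vec.span (g ` (X - {x}))" if x: "x \<in> X" for x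
    proof
      assume "g x \<in> vec.span (g ` (X - {x}))"
      then have "x \<in> vec.span (X - {x})" using gin[of x "X - {x}"] x X(1) by blast
      then show False using X(2) x unfolding vec.dependent_def by blast
    qed
    show "inj_on g X"
    proof (rule inj_onI, rule ccontr)
      fix x y assume "x \<in> X" "y \<in> X" "g x = g y" "x \<noteq> y"
      then have "g x \<in> g ` (X - {x})" by (metis DiffI image_eqI singletonD)
      then show False using main[OF \<open>x \<in> X\<close>] by (simp add: vec.span_base)
    qed
    show "vec.independent (g ` X)"
      unfolding vec.dependent_def
    proof clarify
      fix x assume x: "x \<in> X" "g x \<in> vec.span (g ` X - {g x})"
      have "g ` X - {g x} \<subseteq> g ` (X - {x})" by auto
      then have "g x \<in> vec.span (g ` (X - {x}))"
        using x(2) vec.span_mono[of "g ` X - {g x}" "g ` (X - {x})"] by (simp add: subset_iff)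
      then show False using main[OF x(1)] by simp
    qed
  qed
qed

text \<open>The vectors \<open>b i\<close> are the images under \<open>g\<close> of a basis of
  \<open>E\<close>. The automorphism \<open>\<alpha>\<close> permutes the coefficients in
  \<open>'k\<close>, so it disappears from the description of the point set. The index set
  \<open>J\<close> is arbitrary so that it can be all coordinates, or all but one in the case of a
  hyperplane.\<close>

lemma subgeometry_coords:
  fixes B :: "('K ^ 'n) set set" and J :: "'n set"
  assumes "subgeometry \<iota> (int (card J) - 1) B"
  shows "\<exists>b :: 'n \<Rightarrow> 'K ^ 'n. inj_on b J \<and> vec.independent (b ` J) \<and>
    points_of B = {vec.span {\<Sum>i\<in>J. \<iota> (y i) *s b i} | y. \<exists>i\<in>J. y i \<noteq> 0}"
proof -
  obtain E f g where E: "pspace (int (card J) - 1) (E :: ('k ^ 'n) set)"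
    and bij: "bij_betw f (subspaces_of E) B"
    and ord: "\<forall>U\<in>subspaces_of E. \<forall>W\<in>subspaces_of E. U \<subseteq> W \<longleftrightarrow> f U \<subseteq> f W"
    and sl: "semilinear_on \<iota> E g" and f: "\<forall>W\<in>subspaces_of E. f W = vec.span (g ` W)"
    using assms unfolding subgeometry_def by (elim exE conjE) (rule that)
  have sub: "vec.subspace E" and dim: "vec.dim E = card J" using E by (auto simp: pspace_def)
  note sg = subgeometry_points[OF sub bij ord sl f]
  obtain \<alpha> where g: "\<And>x y. x \<in> E \<Longrightarrow> y \<in> E \<Longrightarrow> g (x + y) = g x + g y"
      "\<And>c x. x \<in> E \<Longrightarrow> g (c *s x) = \<iota> (\<alpha> c) *s g x" "field_embedding \<alpha>" "bij \<alpha>"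
    using sl unfolding semilinear_on_def by blast
  interpret a: field_emb \<alpha> by unfold_locales (rule g(3))
  obtain X where X: "X \<subseteq> E" "vec.independent X" "E \<subseteq> vec.span X" "card X = card J"
    using vec.basis_exists[of E] dim by metis
  have fX: "finite X" by simp
  obtain \<beta> where \<beta>: "bij_betw \<beta> J X"
    using X(4) finite_same_card_bij[of J X] by auto
  have \<beta>E: "\<beta> i \<in> E" if "i \<in> J" for i using \<beta> X(1) that by (auto simp: bij_betw_def)
  have g0: "g 0 = 0" using g(1)[of 0 0] vec.subspace_0[OF sub] by simp
  have gsum: "g (\<Sum>i\<in>I. c i *s \<beta> i) = (\<Sum>i\<in>I. \<iota> (\<alpha> (c i)) *s g (\<beta> i))" if "I \<subseteq> J" for I c
    using finite[of I] that
  proof (induction I rule: finite_induct)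
    case (insert i I)
    have "(\<Sum>i\<in>I. c i *s \<beta> i) \<in> E"
      using insert.prems \<beta>E by (intro vec.subspace_sum[OF sub] vec.subspace_scale[OF sub]) auto
    then show ?case
      using insert \<beta>E g(1,2) vec.subspace_scale[OF sub] by simp
  qed (simp add: g0)
  have elt: "\<exists>c. w = (\<Sum>i\<in>J. c i *s \<beta> i)" if w: "w \<in> E" for w
  proof -
    obtain u where "w = (\<Sum>v\<in>X. u v *s v)"
      using subsetD[OF X(3) w] unfolding vec.span_finite[OF fX] by blast
    also have "\<dots> = (\<Sum>i\<in>J. u (\<beta> i) *s \<beta> i)"
      using sum.reindex_bij_betw[OF \<beta>, of "\<lambda>v. u v *s v"] by simp
    finally show ?thesis by (rule exI[of _ "\<lambda>i. u (\<beta> i)"])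
  qed
  have inE: "(\<Sum>i\<in>J. c i *s \<beta> i) \<in> E" for c
    using \<beta>E by (intro vec.subspace_sum[OF sub] vec.subspace_scale[OF sub]) auto
  have ne0: "(\<Sum>i\<in>J. c i *s \<beta> i) \<noteq> 0 \<longleftrightarrow> (\<exists>i\<in>J. c i \<noteq> 0)" for c
  proof -
    have eq: "(\<Sum>i\<in>J. c i *s \<beta> i) = (\<Sum>v\<in>X. c (inv_into J \<beta> v) *s v)"
      using sum.reindex_bij_betw[OF \<beta>, of "\<lambda>v. c (inv_into J \<beta> v) *s v"] \<beta>
      by (simp add: bij_betw_def)
    have "c i = 0" if "(\<Sum>i\<in>J. c i *s \<beta> i) = 0" "i \<in> J" for i
    proof -
      have "c (inv_into J \<beta> (\<beta> i)) = 0"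
        using that eq \<beta> vec.independentD[OF X(2) fX subset_refl, of "\<lambda>v. c (inv_into J \<beta> v)" "\<beta> i"]
        by (auto simp: bij_betw_def)
      then show ?thesis using \<beta> that(2) by (simp add: bij_betw_def)
    qed
    moreover have "(\<Sum>i\<in>J. c i *s \<beta> i) = 0" if "\<forall>i\<in>J. c i = 0"
      using that by simp
    ultimately show ?thesis by blast
  qed
  define b where "b i = g (\<beta> i)" for i
  have gX: "vec.independent (g ` X)" "inj_on g X" using sg(2)[OF X(1,2)] by auto
  have pts: "points_of B = {vec.span {\<Sum>i\<in>J. \<iota> (y i) *s b i} | y. \<exists>i\<in>J. y i \<noteq> 0}" (is "_ = ?R")
    unfolding sg(1)
  proof (intro antisym subsetI)
    fix P assume "P \<in> {vec.span {g w} | w. w \<in> E \<and> w \<noteq> 0}"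
    then obtain w where w: "w \<in> E" "w \<noteq> 0" "P = vec.span {g w}" by blast
    obtain c where c: "w = (\<Sum>i\<in>J. c i *s \<beta> i)" using elt w(1) by blast
    then have "P = vec.span {\<Sum>i\<in>J. \<iota> (\<alpha> (c i)) *s b i}"
      using w(3) gsum[OF subset_refl] by (simp add: b_def)
    moreover have "\<exists>i\<in>J. \<alpha> (c i) \<noteq> 0" using ne0[of c] w(2) c by simp
    ultimately show "P \<in> ?R" by (intro CollectI exI[of _ "\<lambda>i. \<alpha> (c i)"]) simp
  next
    fix P assume "P \<in> ?R"
    then obtain y where y: "P = vec.span {\<Sum>i\<in>J. \<iota> (y i) *s b i}" "\<exists>i\<in>J. y i \<noteq> 0" by blast
    define c where "c i = inv \<alpha> (y i)" for i
    have yc: "y i = \<alpha> (c i)" for i unfolding c_def using g(4) by (simp add: bij_def surj_f_inv_f)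
    have "P = vec.span {g (\<Sum>i\<in>J. c i *s \<beta> i)}"
      using y(1) gsum[OF subset_refl] by (simp add: b_def yc)
    moreover have "(\<Sum>i\<in>J. c i *s \<beta> i) \<noteq> 0" using y(2) ne0[of c] by (simp add: yc)
    ultimately show "P \<in> {vec.span {g w} | w. w \<in> E \<and> w \<noteq> 0}" using inE by blast
  qed
  have injb: "inj_on b J"
    using comp_inj_on[of \<beta> J g] \<beta> gX(2) unfolding bij_betw_def b_def inj_on_def comp_def by blast
  have "b ` J = g ` X" using \<beta> by (auto simp: bij_betw_def b_def)
  then have "vec.independent (b ` J)" using gX(1) by simp
  then show ?thesis using pts injb by (intro exI[of _ b] conjI)
qed

section \<open>Full-dimensional subgeometries as images of the rational vectors\<close>

lemma emb_comb: "comb b (emb \<iota> y) = (\<Sum>i\<in>UNIV. \<iota> (y $ i) *s b i)"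
  by (simp add: comb_def)

lemma subgeometry_full:
  fixes B :: "('K ^ 'n) set set"
  assumes "subgeometry \<iota> (int CARD('n) - 1) B"
  shows "\<exists>T :: 'K ^ 'n \<Rightarrow> 'K ^ 'n. Vector_Spaces.linear (*s) (*s) T \<and> bij T \<and>
    points_of B = {vec.span {T (emb \<iota> y)} | y. y \<noteq> 0}"
proof -
  obtain b :: "'n \<Rightarrow> 'K ^ 'n" where b: "inj b" "vec.independent (range b)"
    "points_of B = {vec.span {\<Sum>i\<in>UNIV. \<iota> (y i) *s b i} | y. \<exists>i\<in>UNIV. y i \<noteq> 0}"
    using subgeometry_coords[of UNIV, OF assms] by blast
  have "points_of B = {vec.span {comb b (emb \<iota> y)} | y. y \<noteq> 0}"
    unfolding b(3) emb_comb
  proof (intro antisym subsetI; clarify)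
    fix y :: "'n \<Rightarrow> 'k" and i assume "y i \<noteq> 0"
    then show "\<exists>z. vec.span {\<Sum>i\<in>UNIV. \<iota> (y i) *s b i} = vec.span {\<Sum>i\<in>UNIV. \<iota> (z $ i) *s b i} \<and> z \<noteq> 0"
      by (intro exI[of _ "\<chi> i. y i"]) (auto simp: vec_eq_iff)
  next
    fix z :: "'k ^ 'n" assume "z \<noteq> 0"
    then show "\<exists>y. vec.span {\<Sum>i\<in>UNIV. \<iota> (z $ i) *s b i} = vec.span {\<Sum>i\<in>UNIV. \<iota> (y i) *s b i} \<and>
        (\<exists>i\<in>UNIV. y i \<noteq> 0)"
      by (intro exI[of _ "\<lambda>i. z $ i"]) (auto simp: vec_eq_iff)
  qed
  then show ?thesis
    by (intro exI[of _ "comb b"] conjI linear_comb bij_comb[OF b(1,2)])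
qed

text \<open>The subgeometry consists of the \<open>'K\<close>-spans of the images of the subspaces
  of \<open>'k ^ 'n\<close>. Inclusion is reflected because \<open>T\<close> is injective and, by
  \<open>emb_in_spanD\<close>, a subspace is recovered from the rational vectors in its
  span.\<close>

lemma subgeometry_exists:
  fixes T :: "'K ^ 'n \<Rightarrow> 'K ^ 'n"
  assumes T: "Vector_Spaces.linear (*s) (*s) T" "bij T"
  shows "\<exists>B. subgeometry \<iota> (int CARD('n) - 1) B \<and>
    points_of B = {vec.span {T (emb \<iota> y)} | y. y \<noteq> 0}"
proof -
  let ?g = "\<lambda>y. T (emb \<iota> y)"
  define f where "f W = vec.span (?g ` W)" for W
  define B where "B = f ` subspaces_of UNIV"
  note sl = semilinear_on_emb[OF T(1), of UNIV]
  have ord: "U \<subseteq> W \<longleftrightarrow> f U \<subseteq> f W" if "U \<in> subspaces_of UNIV" "W \<in> subspaces_of UNIV" for U W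
  proof
    show "f U \<subseteq> f W" if "U \<subseteq> W" unfolding f_def by (intro vec.span_mono image_mono that)
  next
    assume le: "f U \<subseteq> f W"
    show "U \<subseteq> W"
    proof
      fix u assume "u \<in> U"
      then have "T (emb \<iota> u) \<in> vec.span (T ` (emb \<iota> ` W))"
        using le vec.span_base[of "?g u" "?g ` U"] unfolding f_def image_image by blast
      then have "T (emb \<iota> u) \<in> T ` vec.span (emb \<iota> ` W)"
        using vec.linear_span_image[OF T(1)] by metis
      then have "emb \<iota> u \<in> vec.span (emb \<iota> ` W)"
        using T(2) by (auto simp: bij_def inj_def)
      then show "u \<in> W"
        using that(2) emb_in_spanD[of W u] by (simp add: subspaces_of_def)
    qed
  qed
  then have ord': "\<forall>U\<in>subspaces_of UNIV. \<forall>W\<in>subspaces_of UNIV. U \<subseteq> W \<longleftrightarrow> f U \<subseteq> f W"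
    by blast
  have f': "\<forall>W\<in>subspaces_of UNIV. f W = vec.span (?g ` W)"
    by (simp add: f_def)
  have bij: "bij_betw f (subspaces_of UNIV) B"
    unfolding B_def bij_betw_def using ord by (auto intro!: inj_onI)
  have "pspace (int CARD('n) - 1) (UNIV :: ('k ^ 'n) set)"
    by (simp add: pspace_def card_cart_basis)
  then have "subgeometry \<iota> (int CARD('n) - 1) B"
    unfolding subgeometry_def using bij ord' sl f'
    by (intro exI[of _ UNIV] exI[of _ f] conjI exI[of _ ?g])
  moreover have "points_of B = {vec.span {T (emb \<iota> y)} | y. y \<noteq> 0}"
    using subgeometry_points(1)[OF vec.subspace_UNIV bij ord' sl f'] by simp
  ultimately show ?thesis by (intro exI[of _ B] conjI)
qed

text \<open>The vectors \<open>b i\<close> spanning the subgeometry \<open>C\<close> lie in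
  \<open>\<Sigma>\<close>, since each spans a point of \<open>C\<close>, and by dimension they form
  a basis of it. They are indexed by the coordinates other than \<open>i0\<close>. A vector
  \<open>v0\<close> off \<open>\<Sigma>\<close> takes the place \<open>i0\<close>, and
  \<open>T\<close> sends the unit vectors to this basis.\<close>

lemma subgeometry_of_hyperplane_coords:
  fixes \<Sigma> :: "('K ^ 'n) set" and i0 :: 'n
  assumes n: "CARD('n) = t + 1" and \<Sigma>: "pspace (int t - 1) \<Sigma>"
    and C: "subgeometry \<iota> (int t - 1) C" "\<forall>U\<in>C. U \<subseteq> \<Sigma>"
  shows "\<exists>T. Vector_Spaces.linear (*s) (*s) T \<and> bij T \<and> T ` {x. x $ i0 = 0} = \<Sigma> \<and>
    points_of C = {vec.span {T (emb \<iota> w)} | w. w $ i0 = 0 \<and> w \<noteq> 0}"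
proof -
  define J where "J = UNIV - {i0}"
  have J: "card J = t" using n by (simp add: J_def)
  obtain b :: "'n \<Rightarrow> 'K ^ 'n" where b: "inj_on b J" "vec.independent (b ` J)"
    "points_of C = {vec.span {\<Sum>i\<in>J. \<iota> (y i) *s b i} | y. \<exists>i\<in>J. y i \<noteq> 0}"
    using subgeometry_coords[of J C] C(1) J by blast
  have sub: "vec.subspace \<Sigma>" and dim: "vec.dim \<Sigma> = t" using \<Sigma> by (auto simp: pspace_def)
  have b\<Sigma>: "b i \<in> \<Sigma>" if i: "i \<in> J" for i
  proof -
    let ?y = "\<lambda>j. if j = i then 1 else 0 :: 'k"
    have "(\<Sum>j\<in>J. \<iota> (?y j) *s b j) = (\<Sum>j\<in>J. if j = i then b j else 0)"
      by (rule sum.cong) auto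
    then have "(\<Sum>j\<in>J. \<iota> (?y j) *s b j) = b i" using i by simp
    moreover have "vec.span {\<Sum>j\<in>J. \<iota> (?y j) *s b j} \<in> points_of C"
      unfolding b(3) using i by (intro CollectI exI[of _ ?y] conjI refl bexI[of _ i]) simp
    ultimately have "vec.span {b i} \<subseteq> \<Sigma>" using C(2) by (simp add: points_of_def)
    then show ?thesis using vec.span_base[of "b i" "{b i}"] by blast
  qed
  have "\<Sigma> \<noteq> UNIV" using dim n by (metis vec_dim_card n_not_Suc_n Suc_eq_plus1)
  then obtain v0 where v0: "v0 \<notin> \<Sigma>" by blast
  define b' where "b' = b(i0 := v0)"
  have b'J: "b' i = b i" if "i \<in> J" for i using that by (simp add: b'_def J_def)
  have img: "b' ` J = b ` J" using b'J by auto
  have rng: "range b' = insert v0 (b ` J)"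
  proof -
    have "UNIV = insert i0 J" by (auto simp: J_def)
    then have "range b' = insert (b' i0) (b' ` J)" by (metis image_insert)
    then show ?thesis using img by (simp add: b'_def)
  qed
  have sp\<Sigma>: "vec.span (b ` J) \<subseteq> \<Sigma>"
    using b\<Sigma> by (intro vec.span_minimal sub) auto
  have indep: "vec.independent (range b')"
    unfolding rng using b(2) sp\<Sigma> v0 by (intro vec.independent_insertI) auto
  have inj: "inj b'"
  proof (rule injI)
    fix i j assume eq: "b' i = b' j"
    have ne: "b' k \<noteq> b' i0" if "k \<noteq> i0" for k
      using b\<Sigma>[of k] v0 that by (auto simp: b'_def J_def)
    show "i = j"
    proof (cases "i = i0 \<or> j = i0")
      case True
      then show ?thesis using ne eq by metis
    next
      case False
      then have "i \<in> J" "j \<in> J" by (auto simp: J_def)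
      then show ?thesis using b(1) b'J eq by (metis inj_onD)
    qed
  qed
  define T where "T = comb b'"
  have lin: "Vector_Spaces.linear (*s) (*s) T" and bij: "bij T"
    unfolding T_def using linear_comb bij_comb[OF inj indep] by auto
  have TJ: "T x = (\<Sum>i\<in>J. x $ i *s b i)" if "x $ i0 = 0" for x
  proof -
    have "T x = (\<Sum>i\<in>J. x $ i *s b' i)"
      unfolding T_def comb_def using that by (intro sum.mono_neutral_right) (auto simp: J_def)
    then show ?thesis using b'J by simp
  qed
  have "T ` {x. x $ i0 = 0} = \<Sigma>"
  proof
    show "T ` {x. x $ i0 = 0} \<subseteq> \<Sigma>"
      using TJ b\<Sigma> by (auto intro!: vec.subspace_sum[OF sub] vec.subspace_scale[OF sub])
    have "card (b ` J) = vec.dim \<Sigma>" using b(1) J dim by (simp add: card_image)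
    then have "\<Sigma> \<subseteq> vec.span (b ` J)"
      using vec.card_eq_dim[of "b ` J" \<Sigma>] b(2) b\<Sigma> by auto
    also have "\<dots> \<subseteq> T ` {x. x $ i0 = 0}"
    proof (rule vec.span_minimal)
      show "vec.subspace (T ` {x. x $ i0 = 0})"
        by (rule vec.linear_subspace_image[OF lin]) (auto intro!: vec.subspaceI)
      show "b ` J \<subseteq> T ` {x. x $ i0 = 0}"
      proof (rule image_subsetI)
        fix i assume i: "i \<in> J"
        then have "b i = T (axis i 1)" using b'J by (simp add: T_def)
        moreover have "axis i 1 $ i0 = (0::'K)" using i by (simp add: axis_def J_def)
        ultimately show "b i \<in> T ` {x. x $ i0 = 0}" by blast
      qed
    qed
    finally show "\<Sigma> \<subseteq> T ` {x. x $ i0 = 0}" .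
  qed
  moreover have "points_of C = {vec.span {T (emb \<iota> w)} | w. w $ i0 = 0 \<and> w \<noteq> 0}" (is "_ = ?R")
    unfolding b(3)
  proof (intro antisym subsetI)
    fix P assume "P \<in> {vec.span {\<Sum>i\<in>J. \<iota> (y i) *s b i} | y. \<exists>i\<in>J. y i \<noteq> 0}"
    then obtain y j where y: "P = vec.span {\<Sum>i\<in>J. \<iota> (y i) *s b i}" "j \<in> J" "y j \<noteq> 0" by blast
    let ?w = "\<chi> i. if i = i0 then 0 else y i"
    have "T (emb \<iota> ?w) = (\<Sum>i\<in>J. \<iota> (y i) *s b i)"
      by (subst TJ) (auto simp: J_def intro!: sum.cong)
    moreover have "?w $ j \<noteq> 0" using y by (simp add: J_def)
    then have "?w \<noteq> 0" by (metis zero_index)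
    ultimately show "P \<in> ?R" using y(1) by (intro CollectI exI[of _ ?w]) simp
  next
    fix P assume "P \<in> ?R"
    then obtain w where w: "P = vec.span {T (emb \<iota> w)}" "w $ i0 = 0" "w \<noteq> 0" by blast
    then obtain j where j: "w $ j \<noteq> 0" by (auto simp: vec_eq_iff)
    have "j \<in> J" using j w(2) by (auto simp: J_def)
    then show "P \<in> {vec.span {\<Sum>i\<in>J. \<iota> (y i) *s b i} | y. \<exists>i\<in>J. y i \<noteq> 0}"
      using w j TJ[of "emb \<iota> w"] by (intro CollectI exI[of _ "\<lambda>i. w $ i"]) auto
  qed
  ultimately show ?thesis using lin bij by (intro exI[of _ T] conjI)
qed

end

section \<open>The lines of \<open>Y\<close> in coordinates\<close>

locale hyperplane_coords = field_emb \<iota> for \<iota> :: "'k::{field,finite} \<Rightarrow> 'K::{field,finite}" +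
  fixes T :: "'K ^ 'n \<Rightarrow> 'K ^ 'n" and i0 :: 'n and \<Sigma> :: "('K ^ 'n) set" and C :: "('K ^ 'n) set set"
    and t :: nat
  assumes n: "CARD('n) = t + 1" and t: "t \<noteq> 0"
    and lin: "Vector_Spaces.linear (*s) (*s) T" and bij: "bij T"
    and T_hyperplane: "T ` {x. x $ i0 = 0} = \<Sigma>"
    and C: "points_of C = {vec.span {T (emb \<iota> w)} | w. w $ i0 = 0 \<and> w \<noteq> 0}"
begin

section \<open>Affine coordinates off the hyperplane\<close>

lemma T_eq_iff [simp]: "T x = T y \<longleftrightarrow> x = y"
  using bij by (auto simp: bij_def inj_def)

lemma T_in_hyperplane_iff: "T x \<in> \<Sigma> \<longleftrightarrow> x $ i0 = 0"
  using inj_image_mem_iff[OF bij_is_inj[OF bij], of x "{x. x $ i0 = 0}"] T_hyperplane by simp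

lemma subspace_hyperplane: "vec.subspace \<Sigma>"
  unfolding T_hyperplane[symmetric]
  by (rule vec.linear_subspace_image[OF lin]) (auto intro!: vec.subspaceI)

lemmas T_simps = vec.linear_add[OF lin] vec.linear_scale[OF lin] vec.linear_0[OF lin]

text \<open>In the affine space of points off \<open>\<Sigma>\<close> this is the coset of
  \<open>x\<close> modulo the \<open>c\<close>-multiples of the rational vectors with entry zero at
  \<open>i0\<close>.\<close>

definition yline :: "'K \<Rightarrow> 'K ^ 'n \<Rightarrow> ('K ^ 'n) set set" where
  "yline c x = {vec.span {T (axis i0 1 + x + c *s emb \<iota> w)} | w. w $ i0 = 0}"

lemma points_of_C_subset:
  assumes "P \<in> points_of C"
  shows "P \<subseteq> \<Sigma>"
proof -
  obtain w where "P = vec.span {T (emb \<iota> w)}" "w $ i0 = 0"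
    using assms unfolding C by blast
  then show ?thesis
    using T_in_hyperplane_iff[of "emb \<iota> w"] by (simp add: vec.span_minimal subspace_hyperplane)
qed

lemma off_hyperplane_not_C:
  assumes "v $ i0 \<noteq> 0"
  shows "vec.span {T v} \<notin> points_of C"
proof
  assume "vec.span {T v} \<in> points_of C"
  then have "T v \<in> \<Sigma>" using points_of_C_subset vec.span_base[of "T v" "{T v}"] by blast
  then show False using assms T_in_hyperplane_iff by simp
qed

text \<open>The line is cut out by the image of the rational vectors under
  \<open>T \<circ> M\<close>. The map \<open>M\<close> sends \<open>axis i0 1\<close> to
  \<open>axis i0 1 + x\<close> and multiplies the vectors with entry zero at \<open>i0\<close> by
  \<open>c\<close>, so it fixes every point of \<open>C\<close>.\<close>

lemma yline_is_line:
  assumes c: "c \<noteq> 0" and x: "x $ i0 = 0"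
  shows "yline c x \<in> Y_lines \<iota> t C"
proof -
  define M where "M y = y $ i0 *s (axis i0 1 + x) + c *s (y - y $ i0 *s axis i0 1)" for y
  have linM: "Vector_Spaces.linear (*s) (*s) M"
    by (rule Vector_Spaces.linear.intro)
      (unfold_locales, auto simp: M_def vec_eq_iff algebra_simps)
  have linTM: "Vector_Spaces.linear (*s) (*s) (T \<circ> M)"
    by (rule Vector_Spaces.linear_compose[OF linM lin])
  have M0: "M y $ i0 = y $ i0" for y
    using x by (simp add: M_def axis_def)
  have "inj (T \<circ> M)"
  proof (rule injI)
    fix y z assume "(T \<circ> M) y = (T \<circ> M) z"
    then have eq: "M y = M z" by simp
    then have "y $ i0 = z $ i0" using M0 by metis
    then show "y = z" using eq c by (simp add: M_def)
  qed
  then have bijTM: "bij (T \<circ> M)"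
    using finite_UNIV_inj_surj[of "T \<circ> M"] by (simp add: bij_def)
  obtain B where B: "subgeometry \<iota> (int CARD('n) - 1) B"
    "points_of B = {vec.span {(T \<circ> M) (emb \<iota> y)} | y. y \<noteq> 0}"
    using subgeometry_exists[OF linTM bijTM] by (elim exE conjE) (rule that)
  have MC: "vec.span {(T \<circ> M) (emb \<iota> y)} = vec.span {T (emb \<iota> y)}" if "y $ i0 = 0" for y
  proof -
    have "(T \<circ> M) (emb \<iota> y) = c *s T (emb \<iota> y)" using that by (simp add: M_def T_simps)
    then show ?thesis using span_scale_singleton[OF c] by simp
  qed
  have Mline: "(T \<circ> M) (emb \<iota> (axis i0 1 + w)) = T (axis i0 1 + x + c *s emb \<iota> w)" if "w $ i0 = 0" for w
    using that by (simp add: M_def emb_add axis_nth)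
  have CB: "points_of C \<subseteq> points_of B"
  proof
    fix P assume "P \<in> points_of C"
    then obtain w where w: "P = vec.span {T (emb \<iota> w)}" "w $ i0 = 0" "w \<noteq> 0"
      unfolding C by blast
    then show "P \<in> points_of B"
      unfolding B(2) using MC by (intro CollectI exI[of _ w]) simp
  qed
  have "yline c x = points_of B - points_of C"
  proof (intro antisym subsetI)
    fix P assume "P \<in> yline c x"
    then obtain w where w: "P = vec.span {T (axis i0 1 + x + c *s emb \<iota> w)}" "w $ i0 = 0"
      unfolding yline_def by blast
    have "(axis i0 1 + w) $ i0 \<noteq> 0" using w(2) by (simp add: axis_def)
    then have "axis i0 1 + w \<noteq> 0" by (metis zero_index)
    then have "P \<in> points_of B"
      unfolding B(2) using w Mline by (intro CollectI exI[of _ "axis i0 1 + w"]) simp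
    moreover have "P \<notin> points_of C"
      unfolding w(1) by (rule off_hyperplane_not_C) (use w x in \<open>simp add: axis_def\<close>)
    ultimately show "P \<in> points_of B - points_of C" by blast
  next
    fix P assume P: "P \<in> points_of B - points_of C"
    then obtain y where y: "P = vec.span {(T \<circ> M) (emb \<iota> y)}" "y \<noteq> 0"
      unfolding B(2) by blast
    have y0: "y $ i0 \<noteq> 0"
    proof
      assume "y $ i0 = 0"
      then have "P \<in> points_of C"
        unfolding C using y MC by (intro CollectI exI[of _ y]) simp
      then show False using P by blast
    qed
    \<comment> \<open>Normalising the entry at \<open>i0\<close> to one uses a scalar of
      \<open>'k\<close>, so the vector stays rational and spans the same point.\<close>
    define w where "w = inverse (y $ i0) *s y - axis i0 1"
    have w: "w $ i0 = 0" using y0 by (simp add: w_def axis_def)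
    have e: "(T \<circ> M) (emb \<iota> (axis i0 1 + w)) = \<iota> (inverse (y $ i0)) *s (T \<circ> M) (emb \<iota> y)"
      by (simp add: w_def emb_scale del: comp_apply) (rule vec.linear_scale[OF linTM])
    have "vec.span {\<iota> (inverse (y $ i0)) *s (T \<circ> M) (emb \<iota> y)} = P"
      unfolding y(1) by (rule span_scale_singleton) (use y0 in simp)
    then have "P = vec.span {T (axis i0 1 + x + c *s emb \<iota> w)}"
      unfolding e[symmetric] Mline[OF w] by (rule sym)
    then show "P \<in> yline c x" unfolding yline_def using w by blast
  qed
  moreover have "int CARD('n) - 1 = int t" using n by simp
  ultimately show ?thesis
    unfolding Y_lines_def using B(1) CB by (intro CollectI exI[of _ B]) simp
qed

text \<open>
  Comparing the scalars of the basis vectors of \<open>C\<close> with the scalar of their sum shows that one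
  scalar moves all \<open>k\<close>-rational vectors of \<open>\<Sigma>\<close> into the lattice of \<open>T'\<close>.
\<close>

lemma common_scalar:
  fixes T' :: "'K ^ 'n \<Rightarrow> 'K ^ 'n"
  assumes lin': "Vector_Spaces.linear (*s) (*s) T'" and bij': "bij T'"
    and sub: "points_of C \<subseteq> {vec.span {T' (emb \<iota> y)} | y. y \<noteq> 0}"
  shows "\<exists>\<mu>. \<mu> \<noteq> 0 \<and> (\<forall>w. w $ i0 = 0 \<longrightarrow> (\<exists>z. \<mu> *s T (emb \<iota> w) = T' (emb \<iota> z)))"
proof -
  define J where "J = UNIV - {i0}"
  have inj': "T' x = T' y \<longleftrightarrow> x = y" for x y using bij' by (auto simp: bij_def inj_def)
  have ex: "\<exists>y \<mu>. \<mu> \<noteq> 0 \<and> T' (emb \<iota> y) = \<mu> *s T (emb \<iota> w)" if "w $ i0 = 0" "w \<noteq> 0" for w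
  proof -
    have "vec.span {T (emb \<iota> w)} \<in> {vec.span {T' (emb \<iota> y)} | y. y \<noteq> 0}"
      using sub that unfolding C by blast
    then obtain y where y: "vec.span {T (emb \<iota> w)} = vec.span {T' (emb \<iota> y)}" "y \<noteq> 0" by blast
    then have "T' (emb \<iota> y) \<in> vec.span {T (emb \<iota> w)}" by (simp add: vec.span_base)
    then obtain \<mu> where \<mu>: "T' (emb \<iota> y) = \<mu> *s T (emb \<iota> w)" by (auto simp: vec.span_singleton)
    have "T' (emb \<iota> y) \<noteq> 0" using inj'[of "emb \<iota> y" 0] y(2) vec.linear_0[OF lin'] by simp
    then have "\<mu> \<noteq> 0" using \<mu> by auto
    then show ?thesis using \<mu> by blast
  qed
  have ax: "axis i (1::'k) $ i0 = 0" "axis i (1::'k) \<noteq> 0" if "i \<in> J" for i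
    using that by (auto simp: axis_def J_def vec_eq_iff)
  have "\<forall>i\<in>J. \<exists>p. snd p \<noteq> 0 \<and> T' (emb \<iota> (fst p)) = snd p *s T (axis i 1)"
  proof
    fix i assume i: "i \<in> J"
    obtain y \<mu> where "\<mu> \<noteq> 0" "T' (emb \<iota> y) = \<mu> *s T (emb \<iota> (axis i 1))" using ex[OF ax[OF i]] by blast
    then show "\<exists>p. snd p \<noteq> 0 \<and> T' (emb \<iota> (fst p)) = snd p *s T (axis i 1)"
      by (intro exI[of _ "(y, \<mu>)"]) simp
  qed
  then obtain p where p: "\<And>i. i \<in> J \<Longrightarrow> snd (p i) \<noteq> 0 \<and> T' (emb \<iota> (fst (p i))) = snd (p i) *s T (axis i 1)"
    using bchoice[of J] by metis
  define y where "y i = fst (p i)" for i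
  define l where "l i = snd (p i)" for i
  have l: "l i \<noteq> 0" and yl: "T' (emb \<iota> (y i)) = l i *s T (axis i 1)" if "i \<in> J" for i
    using p[OF that] by (auto simp: y_def l_def)
  have expand: "w = (\<Sum>i\<in>J. w $ i *s axis i 1)" if "w $ i0 = 0" for w :: "'K ^ 'n"
  proof -
    have "w = (\<Sum>i\<in>UNIV. w $ i *s axis i 1)" by (simp add: basis_expansion)
    also have "\<dots> = (\<Sum>i\<in>J. w $ i *s axis i 1)"
      using that by (intro sum.mono_neutral_right) (auto simp: J_def)
    finally show ?thesis .
  qed
  \<comment> \<open>\<open>\<sigma>\<close> is the sum of the unit vectors other than
    \<open>axis i0 1\<close>. Its scalar \<open>\<mu>\<close> is compared with the scalars
    \<open>l i\<close> of the summands.\<close>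
  define \<sigma> :: "'k ^ 'n" where "\<sigma> = (\<chi> i. if i = i0 then 0 else 1)"
  have "card J = t" using n by (simp add: J_def)
  then have "J \<noteq> {}" using t by auto
  then obtain j where j: "j \<in> J" by blast
  have \<sigma>: "\<sigma> $ i0 = 0" "\<sigma> $ j \<noteq> 0" using j by (auto simp: \<sigma>_def J_def)
  then have "\<sigma> \<noteq> 0" by (metis zero_index)
  then obtain z \<mu> where z: "\<mu> \<noteq> 0" "T' (emb \<iota> z) = \<mu> *s T (emb \<iota> \<sigma>)" using ex[OF \<sigma>(1)] by blast
  have \<sigma>J: "emb \<iota> \<sigma> = (\<Sum>i\<in>J. axis i 1)"
    using expand[of "emb \<iota> \<sigma>"] by (simp add: \<sigma>_def J_def)
  \<comment> \<open>\<open>W\<close> is the \<open>'k\<close>-span of the vectors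
    \<open>y i\<close>. Since \<open>emb \<iota> z\<close> is a \<open>'K\<close>-combination of the
    vectors \<open>emb \<iota> (y i)\<close>, \<open>emb_in_spanD\<close> puts \<open>z\<close> into
    \<open>W\<close>. This is what makes the ratios \<open>\<mu> / l i\<close> elements of the
    subfield.\<close>
  define W where "W = range (\<lambda>c. \<Sum>i\<in>J. c i *s y i)"
  have W: "vec.subspace W"
  proof (rule vec.subspaceI)
    show "0 \<in> W" unfolding W_def by (rule image_eqI[of _ _ "\<lambda>i. 0"]) auto
  next
    fix u v assume "u \<in> W" "v \<in> W"
    then obtain c c' where "u = (\<Sum>i\<in>J. c i *s y i)" "v = (\<Sum>i\<in>J. c' i *s y i)"
      by (auto simp: W_def)
    then show "u + v \<in> W"
      unfolding W_def by (intro image_eqI[of _ _ "\<lambda>i. c i + c' i"])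
        (auto simp: vec.scale_left_distrib sum.distrib)
  next
    fix a u assume "u \<in> W"
    then obtain c where "u = (\<Sum>i\<in>J. c i *s y i)" by (auto simp: W_def)
    then show "a *s u \<in> W"
      unfolding W_def by (intro image_eqI[of _ _ "\<lambda>i. a * c i"]) (auto simp: vec.scale_sum_right)
  qed
  have yW: "y i \<in> W" if i: "i \<in> J" for i
  proof -
    have "(\<Sum>k\<in>J. (if k = i then 1 else 0) *s y k) = (\<Sum>k\<in>J. if k = i then y k else 0)"
      by (rule sum.cong) auto
    then have "y i = (\<Sum>k\<in>J. (if k = i then 1 else 0) *s y k)" using i by simp
    then show ?thesis unfolding W_def by (rule range_eqI[where x = "\<lambda>k. if k = i then 1 else 0"])
  qed
  have "emb \<iota> z = (\<Sum>i\<in>J. (\<mu> / l i) *s emb \<iota> (y i))"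
  proof -
    have "T' (\<Sum>i\<in>J. (\<mu> / l i) *s emb \<iota> (y i)) = (\<Sum>i\<in>J. (\<mu> / l i) *s T' (emb \<iota> (y i)))"
      by (simp add: vec.linear_sum[OF lin'] vec.linear_scale[OF lin'])
    also have "\<dots> = (\<Sum>i\<in>J. \<mu> *s T (axis i 1))"
      using l yl by (intro sum.cong refl) simp
    also have "\<dots> = \<mu> *s T (emb \<iota> \<sigma>)"
      by (simp add: \<sigma>J vec.linear_sum[OF lin] vec.scale_sum_right)
    finally show ?thesis using z(2) inj' by metis
  qed
  also have "\<dots> \<in> vec.span (emb \<iota> ` W)"
    using yW by (intro vec.span_sum vec.span_scale vec.span_base) auto
  finally have "z \<in> W" by (rule emb_in_spanD[OF W])
  then obtain c where c: "z = (\<Sum>i\<in>J. c i *s y i)" by (auto simp: W_def)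
  have emb_sum: "T' (emb \<iota> (\<Sum>i\<in>J. a i *s y i)) = (\<Sum>i\<in>J. \<iota> (a i) *s T' (emb \<iota> (y i)))" for a
  proof -
    have "T' (emb \<iota> (\<Sum>i\<in>I. a i *s y i)) = (\<Sum>i\<in>I. \<iota> (a i) *s T' (emb \<iota> (y i)))" for I
      using finite[of I]
      by (induction I rule: finite_induct)
        (simp_all add: emb_add emb_scale vec.linear_add[OF lin'] vec.linear_scale[OF lin'] vec.linear_0[OF lin'])
    then show ?thesis .
  qed
  have cl: "\<iota> (c i) * l i = \<mu>" if i: "i \<in> J" for i
  proof -
    have "T (\<mu> *s emb \<iota> \<sigma>) = (\<Sum>i\<in>J. \<iota> (c i) *s T' (emb \<iota> (y i)))"
      using z(2) c emb_sum[of c] by (simp add: T_simps)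
    also have "\<dots> = (\<Sum>i\<in>J. (\<iota> (c i) * l i) *s T (axis i 1))"
      using yl by (intro sum.cong refl) simp
    also have "\<dots> = T (\<Sum>i\<in>J. (\<iota> (c i) * l i) *s axis i 1)"
      by (simp add: vec.linear_sum[OF lin] vec.linear_scale[OF lin])
    finally have "\<mu> *s emb \<iota> \<sigma> = (\<Sum>i\<in>J. (\<iota> (c i) * l i) *s axis i 1)" by simp
    then have "(\<mu> *s emb \<iota> \<sigma>) $ i = (\<Sum>k\<in>J. (\<iota> (c k) * l k) * (axis k 1 $ i))"
      by (simp only: sum_component vector_smult_component)
    also have "\<dots> = (\<Sum>k\<in>J. if k = i then \<iota> (c k) * l k else 0)"
      by (rule sum.cong) (auto simp: axis_def)
    finally show ?thesis using i by (simp add: \<sigma>_def J_def)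
  qed
  \<comment> \<open>The factor \<open>c i\<close> turns each individual scalar \<open>l i\<close>
    into the common scalar \<open>\<mu>\<close>.\<close>
  have "\<mu> *s T (emb \<iota> w) = T' (emb \<iota> (\<Sum>i\<in>J. (w $ i * c i) *s y i))" if "w $ i0 = 0" for w
  proof -
    have "T' (emb \<iota> (\<Sum>i\<in>J. (w $ i * c i) *s y i)) = (\<Sum>i\<in>J. (\<mu> * \<iota> (w $ i)) *s T (axis i 1))"
      unfolding emb_sum using yl by (intro sum.cong refl) (simp add: iota_mult flip: cl)
    also have "\<dots> = \<mu> *s T (\<Sum>i\<in>J. emb \<iota> w $ i *s axis i 1)"
      by (simp add: vec.linear_sum[OF lin] vec.linear_scale[OF lin] vec.scale_sum_right)
    also have "(\<Sum>i\<in>J. emb \<iota> w $ i *s axis i 1) = emb \<iota> w"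
      by (rule expand[symmetric]) (simp add: that)
    finally show ?thesis by simp
  qed
  then show ?thesis using z(1) by blast
qed

text \<open>The points of \<open>B\<close> come from the image of the rational vectors under some
  \<open>T'\<close>. This lattice contains one vector \<open>T u\<close> off \<open>\<Sigma>\<close>
  and, by \<open>common_scalar\<close>, \<open>\<mu>\<close> times all rational vectors of the
  hyperplane in the coordinates of \<open>T\<close>. Together these already generate it over
  \<open>'k\<close>.\<close>

lemma line_is_yline:
  assumes "L \<in> Y_lines \<iota> t C"
  shows "\<exists>c x. c \<noteq> 0 \<and> x $ i0 = 0 \<and> L = yline c x"
proof -
  have "int CARD('n) - 1 = int t" using n by simp
  then obtain B where L: "L = points_of B - points_of C" and B: "subgeometry \<iota> (int CARD('n) - 1) B"
    and CB: "points_of C \<subseteq> points_of B"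
    using assms unfolding Y_lines_def by auto
  obtain T' :: "'K ^ 'n \<Rightarrow> 'K ^ 'n" where lin': "Vector_Spaces.linear (*s) (*s) T'" and bij': "bij T'"
    and ptsB: "points_of B = {vec.span {T' (emb \<iota> y)} | y. y \<noteq> 0}"
    using subgeometry_full[OF B] by (elim exE conjE) (rule that)
  have inj': "T' x = T' y \<longleftrightarrow> x = y" for x y using bij' by (auto simp: bij_def inj_def)
  note T'_simps = vec.linear_add[OF lin'] vec.linear_scale[OF lin'] vec.linear_0[OF lin']
  obtain \<mu> where \<mu>: "\<mu> \<noteq> 0" "\<forall>w. w $ i0 = 0 \<longrightarrow> (\<exists>z. \<mu> *s T (emb \<iota> w) = T' (emb \<iota> z))"
    using common_scalar[OF lin' bij' CB[unfolded ptsB]] by blast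
  obtain z where z: "\<And>w. w $ i0 = 0 \<Longrightarrow> T' (emb \<iota> (z w)) = \<mu> *s T (emb \<iota> w)"
    using \<mu>(2) by metis
  \<comment> \<open>Otherwise \<open>T'\<close> would map every unit vector into
    \<open>\<Sigma>\<close> and could not be onto.\<close>
  have "\<exists>y1. T' (emb \<iota> y1) \<notin> \<Sigma>"
  proof (rule ccontr)
    assume "\<nexists>y1. T' (emb \<iota> y1) \<notin> \<Sigma>"
    then have ax: "T' (axis i 1) \<in> \<Sigma>" for i using emb_axis by metis
    obtain v where v: "T' v = T (axis i0 1)" using bij' by (metis bij_pointE)
    have "T' v = T' (\<Sum>i\<in>UNIV. v $ i *s axis i 1)" by (simp only: basis_expansion)
    also have "\<dots> = (\<Sum>i\<in>UNIV. v $ i *s T' (axis i 1))"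
      by (simp add: vec.linear_sum[OF lin'] vec.linear_scale[OF lin'])
    also have "\<dots> \<in> \<Sigma>"
      by (intro vec.subspace_sum[OF subspace_hyperplane] vec.subspace_scale[OF subspace_hyperplane] ax)
    finally show False using v T_in_hyperplane_iff by (simp add: axis_def)
  qed
  then obtain y1 where y1: "T' (emb \<iota> y1) \<notin> \<Sigma>" by blast
  obtain u where u: "T u = T' (emb \<iota> y1)" using bij by (metis bij_pointE)
  have u0: "u $ i0 \<noteq> 0" using y1 u T_in_hyperplane_iff by metis
  \<comment> \<open>Dividing \<open>u + \<mu> *s v\<close> by \<open>u $ i0\<close> gives
    \<open>axis i0 1 + x + c *s v\<close>, which dictates the choice of \<open>x\<close> and
    \<open>c\<close>.\<close>
  define x where "x = inverse (u $ i0) *s u - axis i0 1"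
  define c where "c = \<mu> / u $ i0"
  have x: "x $ i0 = 0" using u0 by (simp add: x_def axis_def)
  have c: "c \<noteq> 0" using \<mu>(1) u0 by (simp add: c_def)
  have ux: "u + \<mu> *s v = u $ i0 *s (axis i0 1 + x + c *s v)" for v
    using u0 by (simp add: x_def c_def vec_eq_iff field_simps)
  define bar :: "'k ^ 'n \<Rightarrow> 'k ^ 'n" where "bar w = w - w $ i0 *s axis i0 1" for w
  have bar0: "bar w $ i0 = 0" for w by (simp add: bar_def axis_def)
  \<comment> \<open>\<open>\<Theta>\<close> writes the lattice of \<open>T'\<close> in terms of
    \<open>u\<close> and the \<open>\<mu>\<close>-multiples of rational vectors. Being injective on
    a finite set, it is onto, so every point of \<open>B\<close> has this form.\<close>
  define \<Theta> where "\<Theta> w = w $ i0 *s y1 + z (bar w)" for w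
  have \<Theta>: "T' (emb \<iota> (\<Theta> w)) = T (\<iota> (w $ i0) *s u + \<mu> *s emb \<iota> (bar w))" for w
    using z[OF bar0[of w]] by (simp add: \<Theta>_def emb_add emb_scale T_simps T'_simps u)
  have "inj \<Theta>"
  proof (rule injI)
    fix w w' assume "\<Theta> w = \<Theta> w'"
    then have eq: "\<iota> (w $ i0) *s u + \<mu> *s emb \<iota> (bar w) = \<iota> (w' $ i0) *s u + \<mu> *s emb \<iota> (bar w')"
      using \<Theta> T_eq_iff by metis
    then have "(\<iota> (w $ i0) *s u + \<mu> *s emb \<iota> (bar w)) $ i0 = (\<iota> (w' $ i0) *s u + \<mu> *s emb \<iota> (bar w')) $ i0"
      by (rule arg_cong)
    then have w0: "w $ i0 = w' $ i0" using u0 bar0 by simp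
    then have "bar w = bar w'" using eq \<mu>(1) by simp
    then show "w = w'" using w0 by (simp add: bar_def)
  qed
  then have surj: "surj \<Theta>" using finite_UNIV_inj_surj[of \<Theta>] by simp
  have "L = yline c x"
    unfolding L
  proof (intro antisym subsetI)
    fix P assume P: "P \<in> points_of B - points_of C"
    then obtain y where y: "P = vec.span {T' (emb \<iota> y)}" "y \<noteq> 0" unfolding ptsB by blast
    obtain w where w: "y = \<Theta> w" using surj by blast
    have Pw: "P = vec.span {T (\<iota> (w $ i0) *s u + \<mu> *s emb \<iota> (bar w))}"
      using y(1) w \<Theta> by simp
    have w0: "w $ i0 \<noteq> 0"
    proof
      assume w0: "w $ i0 = 0"
      then have "T' (emb \<iota> y) = \<mu> *s T (emb \<iota> (bar w))" using w \<Theta> by (simp add: T_simps)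
      moreover have "T' (emb \<iota> y) \<noteq> 0" using inj'[of "emb \<iota> y" 0] y(2) by (simp add: T'_simps)
      ultimately have "bar w \<noteq> 0" by (auto simp: T_simps)
      moreover have "P = vec.span {T (emb \<iota> (bar w))}"
        using Pw w0 span_scale_singleton[OF \<mu>(1)] by (simp add: T_simps)
      ultimately have "P \<in> points_of C" unfolding C using bar0 by blast
      then show False using P by blast
    qed
    define r where "r = w $ i0"
    define w' where "w' = inverse r *s bar w"
    have "\<iota> r * \<iota> (inverse r) = 1" using w0 by (simp add: r_def flip: iota_mult)
    then have "\<iota> r * (\<mu> * \<iota> (inverse r)) = \<mu>" by (simp add: mult.left_commute)
    then have "\<iota> r *s u + \<mu> *s emb \<iota> (bar w) = \<iota> r *s (u + \<mu> *s emb \<iota> w')"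
      by (simp add: w'_def emb_scale vec.scale_right_distrib)
    also have "\<dots> = (\<iota> r * u $ i0) *s (axis i0 1 + x + c *s emb \<iota> w')"
      unfolding ux by simp
    finally have "P = vec.span {(\<iota> r * u $ i0) *s T (axis i0 1 + x + c *s emb \<iota> w')}"
      using Pw by (metis r_def vec.linear_scale[OF lin])
    then have "P = vec.span {T (axis i0 1 + x + c *s emb \<iota> w')}"
      using span_scale_singleton[of "\<iota> r * u $ i0"] u0 w0 by (simp add: r_def)
    moreover have "w' $ i0 = 0" by (simp add: w'_def bar0)
    ultimately show "P \<in> yline c x" unfolding yline_def by blast
  next
    fix P assume "P \<in> yline c x"
    then obtain w where w: "P = vec.span {T (axis i0 1 + x + c *s emb \<iota> w)}" "w $ i0 = 0"
      unfolding yline_def by blast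
    let ?v = "axis i0 1 + x + c *s emb \<iota> w"
    have v0: "?v $ i0 \<noteq> 0" using w(2) x by (simp add: axis_def)
    have "T' (emb \<iota> (y1 + z w)) = T (u + \<mu> *s emb \<iota> w)"
      using z[OF w(2)] by (simp add: emb_add T_simps T'_simps u)
    also have "\<dots> = u $ i0 *s T ?v" unfolding ux by (simp only: T_simps)
    finally have e: "T' (emb \<iota> (y1 + z w)) = u $ i0 *s T ?v" .
    have "P = vec.span {T' (emb \<iota> (y1 + z w))}"
      unfolding w(1) e by (rule span_scale_singleton[OF u0, symmetric])
    moreover have "y1 + z w \<noteq> 0"
    proof
      assume "y1 + z w = 0"
      then have "u $ i0 *s T ?v = 0" using e by (simp only: emb_0 T'_simps)
      then have "T ?v = T 0" using u0 by (simp add: vec.linear_0[OF lin])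
      then have "?v = 0" by (simp only: T_eq_iff)
      then show False using v0 by (metis zero_index)
    qed
    ultimately have "P \<in> points_of B" unfolding ptsB by blast
    then show "P \<in> points_of B - points_of C"
      using off_hyperplane_not_C[OF v0] w(1) by blast
  qed
  then show ?thesis using c x by blast
qed

section \<open>All lines and points of \<open>Y\<close> in coordinates\<close>

lemma Y_lines_eq: "Y_lines \<iota> t C = {yline c x | c x. c \<noteq> 0 \<and> x $ i0 = 0}"
proof (intro antisym subsetI)
  fix L assume "L \<in> Y_lines \<iota> t C"
  then obtain c x where "c \<noteq> 0" "x $ i0 = 0" "L = yline c x"
    using line_is_yline[of L] by (elim meta_impE exE conjE)
  then show "L \<in> {yline c x | c x. c \<noteq> 0 \<and> x $ i0 = 0}" by blast
next
  fix L assume "L \<in> {yline c x | c x. c \<noteq> 0 \<and> x $ i0 = 0}"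
  then show "L \<in> Y_lines \<iota> t C"
    by (elim CollectE exE conjE) (simp add: yline_is_line)
qed

text \<open>A spanning vector of a point off \<open>\<Sigma>\<close> has nonzero entry at
  \<open>i0\<close> in these coordinates, and this entry is scaled to one.\<close>

lemma Y_points_eq: "Y_points \<Sigma> = {vec.span {T (axis i0 1 + x)} | x. x $ i0 = 0}"
proof (intro antisym subsetI)
  fix P assume "P \<in> Y_points \<Sigma>"
  then obtain v where v: "P = vec.span {v}" "\<not> P \<subseteq> \<Sigma>"
    unfolding Y_points_def using pspace_0_iff by blast
  obtain u where u: "v = T u" using bij by (metis bij_pointE)
  have "u $ i0 \<noteq> 0"
  proof
    assume "u $ i0 = 0"
    then have "v \<in> \<Sigma>" using u T_in_hyperplane_iff by simp
    then show False using v vec.span_minimal[OF _ subspace_hyperplane, of "{v}"] by simp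
  qed
  then have "P = vec.span {T (inverse (u $ i0) *s u)}"
    using v(1) u span_scale_singleton[of "inverse (u $ i0)" v] by (simp add: T_simps)
  then have "P = vec.span {T (axis i0 1 + (inverse (u $ i0) *s u - axis i0 1))}" by simp
  moreover have "(inverse (u $ i0) *s u - axis i0 1) $ i0 = 0"
    using \<open>u $ i0 \<noteq> 0\<close> by (simp add: axis_def)
  ultimately show "P \<in> {vec.span {T (axis i0 1 + x)} | x. x $ i0 = 0}" by blast
next
  fix P assume "P \<in> {vec.span {T (axis i0 1 + x)} | x. x $ i0 = 0}"
  then obtain x where x: "P = vec.span {T (axis i0 1 + x)}" "x $ i0 = 0" by blast
  have ne: "T (axis i0 1 + x) \<notin> \<Sigma>" using x T_in_hyperplane_iff by (simp add: axis_def)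
  then have "T (axis i0 1 + x) \<noteq> 0" using vec.subspace_0[OF subspace_hyperplane] by metis
  then have "pspace 0 P" using x(1) pspace_0_iff by blast
  moreover have "T (axis i0 1 + x) \<in> P" unfolding x(1) by (rule vec.span_base) simp
  ultimately show "P \<in> Y_points \<Sigma>" unfolding Y_points_def using ne by blast
qed

end

section \<open>Functionals of the field extension\<close>

lemma card_vec_box:
  fixes A :: "'n::finite \<Rightarrow> 'a::finite set"
  shows "card {x :: 'a ^ 'n. \<forall>i. x $ i \<in> A i} = (\<Prod>i\<in>UNIV. card (A i))"
proof -
  have "bij_betw vec_nth {x :: 'a ^ 'n. \<forall>i. x $ i \<in> A i} (PiE UNIV A)"
    by (rule bij_betw_byWitness[where f' = vec_lambda]) auto
  then show ?thesis by (simp add: bij_betw_same_card card_PiE)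
qed

locale field_extension = field_emb \<iota> for \<iota> :: "'k::{field,finite} \<Rightarrow> 'K::{field,finite}" +
  fixes i0 :: "'n::finite" and s t q :: nat
  assumes card_n: "CARD('n) = t + 1" and t: "t \<noteq> 0"
    and card_k: "CARD('k) = q" and card_K: "CARD('K) = q ^ (s + 1)"
begin

text \<open>This and \<open>kV\<close> below are restrictions of scalars along
  \<open>\<iota>\<close>. Field reduction identifies the subspaces of \<open>'k ^ 'm\<close> with
  the subspaces in the sense of \<open>kV\<close>.\<close>

sublocale kK: finite_vector_space "\<lambda>c (a::'K). \<iota> c * a"
  by unfold_locales (auto simp: iota_add iota_mult algebra_simps)

sublocale kV: finite_vector_space "\<lambda>c (v::'K ^ 'n). \<iota> c *s v"
  by unfold_locales (auto simp: iota_add iota_mult vec_eq_iff algebra_simps)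

lemma q_gt_1: "1 < q"
  using kK.card_scalars_gt_1 card_k by simp

lemma q_power_eq_iff [simp]: "q ^ a = q ^ b \<longleftrightarrow> a = b"
  using q_gt_1 by (simp add: power_inject_exp)

text \<open>The hyperplane that the coordinate map takes to \<open>\<Sigma>\<close>, used here as a
  space over \<open>'k\<close>.\<close>

definition S0 :: "('K ^ 'n) set" where "S0 = {y. y $ i0 = 0}"

lemma subspace_S0: "kV.subspace S0"
  unfolding S0_def by (rule kV.subspaceI) auto

lemma subspace_line: "kV.subspace (range (\<lambda>a. a *s v))"
proof (rule kV.subspaceI)
  show "0 \<in> range (\<lambda>a. a *s v)" by (rule range_eqI[of _ _ 0]) simp
  show "x + y \<in> range (\<lambda>a. a *s v)" if xy: "x \<in> range (\<lambda>a. a *s v)" "y \<in> range (\<lambda>a. a *s v)" for x y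
  proof -
    obtain a b where "x = a *s v" "y = b *s v" using xy by blast
    then show ?thesis by (intro range_eqI[of _ _ "a + b"]) (simp add: vec.scale_left_distrib)
  qed
  show "\<iota> c *s x \<in> range (\<lambda>a. a *s v)" if x: "x \<in> range (\<lambda>a. a *s v)" for c x
  proof -
    obtain a where "x = a *s v" using x by blast
    then show ?thesis by (intro range_eqI[of _ _ "\<iota> c * a"]) simp
  qed
qed

lemma prod_i0: "(\<Prod>i\<in>UNIV. if i = i0 then a else b) = a * b ^ t" for a b :: nat
proof -
  have "(\<Prod>i\<in>UNIV. if i = i0 then a else b) = a * (\<Prod>i\<in>UNIV - {i0}. if i = i0 then a else b)"
    by (subst prod.remove[of _ i0]) auto
  also have "(\<Prod>i\<in>UNIV - {i0}. if i = i0 then a else b) = (\<Prod>i\<in>UNIV - {i0}. b)"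
    by (rule prod.cong) auto
  also have "\<dots> = b ^ t" using card_n by simp
  finally show ?thesis .
qed

lemma card_box_i0:
  fixes A B :: "'K set"
  shows "card {y :: 'K ^ 'n. y $ i0 \<in> A \<and> (\<forall>i. i \<noteq> i0 \<longrightarrow> y $ i \<in> B)} = card A * card B ^ t"
proof -
  have "{y :: 'K ^ 'n. y $ i0 \<in> A \<and> (\<forall>i. i \<noteq> i0 \<longrightarrow> y $ i \<in> B)} =
      {y. \<forall>i. y $ i \<in> (if i = i0 then A else B)}" by auto
  also have "card \<dots> = (\<Prod>i\<in>UNIV. card (if i = i0 then A else B))" by (rule card_vec_box)
  also have "\<dots> = (\<Prod>i\<in>UNIV. if i = i0 then card A else card B)" by (rule prod.cong) auto
  finally show ?thesis by (simp add: prod_i0)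
qed

lemma card_S0: "card S0 = q ^ ((s + 1) * t)"
proof -
  have "S0 = {y. y $ i0 \<in> {0} \<and> (\<forall>i. i \<noteq> i0 \<longrightarrow> y $ i \<in> UNIV)}" by (auto simp: S0_def)
  then have "card S0 = card {0::'K} * CARD('K) ^ t" using card_box_i0[of "{0}" UNIV] by simp
  then show ?thesis unfolding card_K power_mult by simp
qed

lemma card_V: "CARD('K ^ 'n) = q ^ ((s + 1) * (t + 1))"
  by (simp only: CARD_vec card_K card_n power_mult)

definition functional :: "('K \<Rightarrow> 'k) \<Rightarrow> bool" where
  "functional f \<longleftrightarrow> (\<forall>a b. f (a + b) = f a + f b) \<and> (\<forall>c a. f (\<iota> c * a) = c * f a) \<and> (\<exists>a. f a \<noteq> 0)"

text \<open>In coordinates: the set \<open>H^t\<close>, and the subspaces of \<open>K ^ 'n\<close> dual to the points and lines of \<open>X\<close>.\<close>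

definition chi0 :: "('K \<Rightarrow> 'k) \<Rightarrow> ('K ^ 'n) set" where
  "chi0 f = {y. y $ i0 = 0 \<and> (\<forall>i. i \<noteq> i0 \<longrightarrow> f (y $ i) = 0)}"

definition xpt :: "('K \<Rightarrow> 'k) \<Rightarrow> 'K ^ 'n \<Rightarrow> ('K ^ 'n) set" where
  "xpt f x = {y. \<forall>i. i \<noteq> i0 \<longrightarrow> f (y $ i) = f (y $ i0 * x $ i)}"

definition xln :: "('K \<Rightarrow> 'k) \<Rightarrow> 'K \<Rightarrow> 'K ^ 'n \<Rightarrow> ('K ^ 'n) set" where
  "xln f c x = {y \<in> xpt f x. f (c * y $ i0) = 0}"

end

section \<open>The form \<open>f (a * b)\<close> of a functional \<open>f\<close>\<close>

locale extension_functional = field_extension \<iota> i0 s t q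
  for \<iota> :: "'k::{field,finite} \<Rightarrow> 'K::{field,finite}" and i0 :: "'n::finite" and s t q :: nat +
  fixes f :: "'K \<Rightarrow> 'k"
  assumes functional: "functional f"
begin

lemma f_add: "f (a + b) = f a + f b" and f_scale: "f (\<iota> c * a) = c * f a"
  using functional by (auto simp: functional_def)

lemma f_0 [simp]: "f 0 = 0"
  using f_scale[of 0 0] by simp

lemma f_diff: "f (a - b) = f a - f b"
  using f_add[of "a - b" b] by simp

lemma obtain_f_1: obtains a where "f a = 1"
proof -
  obtain a where "f a \<noteq> 0" using functional by (auto simp: functional_def)
  then have "f (\<iota> (inverse (f a)) * a) = 1" by (simp add: f_scale)
  then show ?thesis by (rule that)
qed

text \<open>Nondegeneracy: multiplication by a nonzero \<open>x\<close> is onto, so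
  \<open>f (a * x)\<close> takes the value one for some \<open>a\<close>.\<close>

lemma f_mult_eq_0D:
  assumes "\<And>a. f (a * x) = 0"
  shows "x = 0"
proof (rule ccontr)
  assume "x \<noteq> 0"
  obtain a where "f a = 1" by (rule obtain_f_1)
  then show False using assms[of "a / x"] \<open>x \<noteq> 0\<close> by simp
qed

lemma f_mult_eqD:
  assumes "\<And>a. f (a * x) = f (a * y)"
  shows "x = y"
  using f_mult_eq_0D[of "x - y"] assms by (simp add: right_diff_distrib f_diff)

text \<open>The kernel together with one vector of value one generates the whole field, so its index
  is \<open>q\<close>.\<close>

lemma card_ker: "card {a. f a = 0} = q ^ s"
proof -
  obtain a1 where a1: "f a1 = 1" by (rule obtain_f_1)
  have sub: "kK.subspace {a. f a = 0}"
    by (rule kK.subspaceI) (auto simp: f_add f_scale)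
  have "a1 \<notin> {a. f a = 0}" using a1 by simp
  note ins = kK.subspace_insert_functional(2)[OF sub this]
  have "{z + \<iota> r * a1 | z r. z \<in> {a. f a = 0}} = UNIV"
  proof (intro antisym subsetI UNIV_I)
    fix a
    have "f (a - \<iota> (f a) * a1) = 0" by (simp add: f_diff f_scale a1)
    then show "a \<in> {z + \<iota> r * a1 | z r. z \<in> {a. f a = 0}}"
      by (intro CollectI exI[of _ "a - \<iota> (f a) * a1"] exI[of _ "f a"]) simp
  qed
  then have "q ^ (s + 1) = q * card {a. f a = 0}" using ins card_K card_k by simp
  then show ?thesis using q_gt_1 by simp
qed

lemma card_ker_mult:
  assumes "c \<noteq> 0"
  shows "card {a. f (c * a) = 0} = q ^ s"
proof -
  have "bij_betw (\<lambda>a. c * a) {a. f (c * a) = 0} {a. f a = 0}"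
    by (rule bij_betw_byWitness[where f' = "\<lambda>a. a / c"]) (use assms in auto)
  then show ?thesis using card_ker bij_betw_same_card by metis
qed

text \<open>A counting argument. By nondegeneracy, \<open>x\<close> is determined by the functional
  it defines, hence by its values on a basis \<open>B\<close>. There are
  \<open>CARD('k) ^ card B = CARD('K)\<close> value tables on \<open>B\<close>, so each of them
  comes from some \<open>x\<close>.\<close>

lemma functional_repr:
  assumes g: "\<And>a b. g (a + b) = g a + g b" "\<And>c a. g (\<iota> c * a) = c * g a"
  shows "\<exists>x. \<forall>a. g a = f (a * x)"
proof -
  obtain B where B: "kK.independent B" "UNIV \<subseteq> kK.span B"
    using kK.basis_exists[of UNIV] by metis
  have fB: "finite B" by simp
  have ext: "h = h'" if h: "\<And>a b. h (a + b) = h a + h b" "\<And>c a. h (\<iota> c * a) = c * h a"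
      "\<And>a b. h' (a + b) = h' a + h' b" "\<And>c a. h' (\<iota> c * a) = c * h' a" "\<And>b. b \<in> B \<Longrightarrow> h b = h' b"
    for h h' :: "'K \<Rightarrow> 'k"
  proof
    fix a
    have "h 0 = 0" "h' 0 = 0" using h(2)[of 0 0] h(4)[of 0 0] by simp_all
    then have "kK.subspace {a. h a = h' a}" using h(1-4) by (intro kK.subspaceI) auto
    then have "kK.span B \<subseteq> {a. h a = h' a}" using h(5) by (intro kK.span_minimal) auto
    then show "h a = h' a" using B(2) by blast
  qed
  have m: "f ((a + b) * x) = f (a * x) + f (b * x)" "f (\<iota> c * a * x) = c * f (a * x)" for a b c x
    by (simp_all add: distrib_right f_add mult.assoc f_scale)
  define \<Phi> where "\<Phi> x = restrict (\<lambda>b. f (b * x)) B" for x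
  have "inj \<Phi>"
  proof (rule injI)
    fix x y assume eq: "\<Phi> x = \<Phi> y"
    have "f (b * x) = f (b * y)" if "b \<in> B" for b
      using fun_cong[OF eq, of b] that by (simp add: \<Phi>_def)
    then have "(\<lambda>a. f (a * x)) = (\<lambda>a. f (a * y))" by (intro ext m)
    then show "x = y" by (intro f_mult_eqD) (rule fun_cong)
  qed
  then have cr: "card (range \<Phi>) = CARD('K)" by (rule card_image)
  have "kK.span B = UNIV" using B(2) by blast
  then have "CARD('K) = CARD('k) ^ card B" using kK.card_span_independent[OF B(1)] by simp
  also have "\<dots> = card (B \<rightarrow>\<^sub>E (UNIV :: 'k set))" by (simp add: card_PiE[OF fB])
  finally have c2: "card (range \<Phi>) = card (B \<rightarrow>\<^sub>E (UNIV :: 'k set))" using cr by simp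
  have "range \<Phi> \<subseteq> B \<rightarrow>\<^sub>E UNIV" by (auto simp: \<Phi>_def)
  then have "range \<Phi> = B \<rightarrow>\<^sub>E UNIV"
    using c2 by (intro card_subset_eq finite_PiE) auto
  then have "restrict g B \<in> range \<Phi>" by auto
  then obtain x where x: "restrict g B = \<Phi> x" by blast
  have "g b = f (b * x)" if "b \<in> B" for b
    using fun_cong[OF x, of b] that by (simp add: \<Phi>_def)
  then have "g = (\<lambda>a. f (a * x))" by (intro ext g m)
  then show ?thesis by (intro exI[of _ x]) simp
qed

section \<open>Sizes, sums and characterizations of \<open>chi0\<close>, \<open>xpt\<close> and
  \<open>xln\<close>\<close>

lemma subspace_chi0: "kV.subspace (chi0 f)"
  unfolding chi0_def by (rule kV.subspaceI) (auto simp: f_add f_scale)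

lemma subspace_xpt: "kV.subspace (xpt f x)"
  unfolding xpt_def by (rule kV.subspaceI) (auto simp: f_add f_scale distrib_right mult.assoc)

lemma subspace_xln: "kV.subspace (xln f c x)"
  unfolding xln_def
  by (rule kV.subspaceI)
    (auto simp: f_add f_scale distrib_left mult.left_commute[of c] kV.subspace_0[OF subspace_xpt]
      kV.subspace_add[OF subspace_xpt] kV.subspace_scale[OF subspace_xpt])

lemma chi0_subset_S0: "chi0 f \<subseteq> S0"
  by (auto simp: chi0_def S0_def)

lemma chi0_subset_xln: "chi0 f \<subseteq> xln f c x"
  by (auto simp: chi0_def xpt_def xln_def)

lemma chi0_subset_xpt: "chi0 f \<subseteq> xpt f x"
  by (auto simp: chi0_def xpt_def)

lemma card_chi0: "card (chi0 f) = q ^ (s * t)"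
proof -
  have "chi0 f = {y. y $ i0 \<in> {0} \<and> (\<forall>i. i \<noteq> i0 \<longrightarrow> y $ i \<in> {a. f a = 0})}"
    by (auto simp: chi0_def)
  then have "card (chi0 f) = card {0::'K} * card {a. f a = 0} ^ t"
    using card_box_i0[of "{0}" "{a. f a = 0}"] by simp
  then show ?thesis unfolding card_ker power_mult by simp
qed

text \<open>The shear subtracting \<open>y $ i0 * x $ i\<close> from the entry at \<open>i\<close>
  turns the conditions of \<open>xpt\<close> into independent conditions on the single
  entries.\<close>

lemma card_sheared:
  "card {y \<in> xpt f x. y $ i0 \<in> A} = card A * q ^ (s * t)"
proof -
  let ?sh = "\<lambda>r y. \<chi> i. if i = i0 then y $ i0 else y $ i + r * (y $ i0 * x $ i)"
  have "bij_betw (?sh (-1)) {y \<in> xpt f x. y $ i0 \<in> A}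
      {y. y $ i0 \<in> A \<and> (\<forall>i. i \<noteq> i0 \<longrightarrow> y $ i \<in> {a. f a = 0})}"
    by (rule bij_betw_byWitness[where f' = "?sh 1"])
      (auto simp: xpt_def vec_eq_iff f_diff f_add)
  then show ?thesis
    using card_box_i0[of A "{a. f a = 0}"] by (simp add: bij_betw_same_card card_ker power_mult)
qed

lemma card_xpt: "card (xpt f x) = q ^ (s * t + s + 1)"
  using card_sheared[of x UNIV] by (simp add: card_K power_add)

lemma card_xln:
  assumes "c \<noteq> 0"
  shows "card (xln f c x) = q ^ (s * t + s)"
  using card_sheared[of x "{a. f (c * a) = 0}"]
  unfolding card_ker_mult[OF assms] xln_def power_add[symmetric] by (simp add: add.commute)

text \<open>With \<open>xpt_diff_in_chi0\<close>, this shows that \<open>xpt f x\<close> is the sum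
  of the \<open>'K\<close>-line of \<open>axis i0 1 + x\<close> and \<open>chi0 f\<close>.\<close>

lemma scaled_in_xpt: "x $ i0 = 0 \<Longrightarrow> a *s (axis i0 1 + x) \<in> xpt f x"
  by (simp add: xpt_def axis_def)

lemma xpt_diff_in_chi0:
  assumes "y \<in> xpt f x" "y' \<in> xpt f x" "y $ i0 = y' $ i0"
  shows "y - y' \<in> chi0 f"
  using assms by (simp add: xpt_def chi0_def f_diff)

text \<open>Under the duality this becomes the disjointness of a point of \<open>X\<close> from
  \<open>\<pi>\<close>. The vector \<open>y\<close> is split along
  \<open>axis i0 1 + x\<close>.\<close>

lemma ssum_xpt_S0:
  assumes "x $ i0 = 0"
  shows "ssum (xpt f x) S0 = UNIV"
proof (intro antisym subsetI UNIV_I)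
  fix y
  have "y - y $ i0 *s (axis i0 1 + x) \<in> S0" using assms by (simp add: S0_def)
  then show "y \<in> ssum (xpt f x) S0"
    unfolding ssum_def using scaled_in_xpt[OF assms, of "y $ i0"]
    by (intro CollectI exI[of _ "y $ i0 *s (axis i0 1 + x)"]
        exI[of _ "y - y $ i0 *s (axis i0 1 + x)"]) simp
qed

lemma ssum_xln_S0:
  assumes "x $ i0 = 0"
  shows "ssum (xln f c x) S0 = {y. f (c * y $ i0) = 0}"
proof (intro antisym subsetI)
  fix y assume "y \<in> ssum (xln f c x) S0"
  then show "y \<in> {y. f (c * y $ i0) = 0}" by (auto simp: ssum_def xln_def S0_def)
next
  fix y assume y: "y \<in> {y. f (c * y $ i0) = 0}"
  have "y - y $ i0 *s (axis i0 1 + x) \<in> S0" using assms by (simp add: S0_def)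
  moreover have "y $ i0 *s (axis i0 1 + x) \<in> xln f c x"
    using scaled_in_xpt[OF assms] y assms by (simp add: xln_def)
  ultimately show "y \<in> ssum (xln f c x) S0"
    unfolding ssum_def
    by (intro CollectI exI[of _ "y $ i0 *s (axis i0 1 + x)"]
        exI[of _ "y - y $ i0 *s (axis i0 1 + x)"]) simp
qed

text \<open>The sum is a \<open>'k\<close>-hyperplane, as \<open>s * t + s + t\<close> is one less
  than \<open>(s + 1) * (t + 1)\<close>. Dually, a line of \<open>X\<close> meets
  \<open>\<pi>\<close> in exactly one point.\<close>

lemma card_ssum_xln_S0:
  assumes "c \<noteq> 0" "x $ i0 = 0"
  shows "card (ssum (xln f c x) S0) = q ^ (s * t + s + t)"
proof -
  have "{y :: 'K ^ 'n. f (c * y $ i0) = 0} =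
      {y. y $ i0 \<in> {a. f (c * a) = 0} \<and> (\<forall>i. i \<noteq> i0 \<longrightarrow> y $ i \<in> UNIV)}" by auto
  then have "card {y :: 'K ^ 'n. f (c * y $ i0) = 0} = q ^ s * (q ^ (s + 1)) ^ t"
    using card_box_i0[of "{a. f (c * a) = 0}" UNIV] card_ker_mult[OF assms(1)] card_K by simp
  also have "\<dots> = q ^ (s + (s + 1) * t)" by (simp only: power_add power_mult)
  also have "s + (s + 1) * t = s * t + s + t" by simp
  finally show ?thesis using ssum_xln_S0[OF assms(2)] by simp
qed

text \<open>Counting forces \<open>U \<inter> S0 = chi0 f\<close>. Hence, for \<open>y\<close> in
  \<open>U\<close>, the values \<open>f (y $ i)\<close> depend only on \<open>y $ i0\<close>. This
  dependence is \<open>'k\<close>-linear, and \<open>functional_repr\<close> supplies the entries of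
  \<open>x\<close>.\<close>

lemma xpt_characterization:
  assumes U: "kV.subspace U" "chi0 f \<subseteq> U" "ssum U S0 = UNIV" "card U = q ^ (s * t + s + 1)"
  shows "\<exists>x. x $ i0 = 0 \<and> U = xpt f x"
proof -
  have "q ^ ((s + 1) * (t + 1)) * card (U \<inter> S0) = q ^ (s * t + s + 1) * q ^ ((s + 1) * t)"
    using kV.card_ssum[OF U(1) subspace_S0] U(3,4) card_V card_S0 by simp
  also have "\<dots> = q ^ ((s + 1) * (t + 1)) * q ^ (s * t)"
    unfolding power_add[symmetric] q_power_eq_iff by simp
  finally have "card (U \<inter> S0) = card (chi0 f)" using q_gt_1 card_chi0 by simp
  then have US: "U \<inter> S0 = chi0 f"
    using U(2) chi0_subset_S0 card_subset_eq[of "U \<inter> S0" "chi0 f"] by auto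
  have "\<exists>y. y \<in> U \<and> y $ i0 = a" for a
  proof -
    have "a *s axis i0 1 \<in> ssum U S0" using U(3) by simp
    then obtain y z where "y \<in> U" "z \<in> S0" "a *s axis i0 1 = y + z" unfolding ssum_def by blast
    then have "(a *s axis i0 1) $ i0 = y $ i0" by (simp add: S0_def)
    then show ?thesis using \<open>y \<in> U\<close> by (intro exI[of _ y]) simp
  qed
  \<comment> \<open>An arbitrary choice of preimages. Only the values \<open>f (h a $ i)\<close>
    matter, and they do not depend on the choice.\<close>
  then obtain h where h: "\<And>a. h a \<in> U" "\<And>a. h a $ i0 = a" by metis
  have fU: "f (y $ i) = f (y' $ i)" if "y \<in> U" "y' \<in> U" "y $ i0 = y' $ i0" "i \<noteq> i0" for y y' i
  proof -
    have "y - y' \<in> U \<inter> S0" using kV.subspace_diff[OF U(1) that(1,2)] that(3) by (simp add: S0_def)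
    then have "f ((y - y') $ i) = 0" using US that(4) by (simp add: chi0_def)
    then show ?thesis by (simp add: f_diff)
  qed
  have "\<exists>x. \<forall>a. f (h a $ i) = f (a * x)" if i: "i \<noteq> i0" for i
  proof (rule functional_repr)
    fix a b c
    show "f (h (a + b) $ i) = f (h a $ i) + f (h b $ i)"
      using fU[OF h(1) kV.subspace_add[OF U(1) h(1) h(1)], of "a + b" a b i] i by (simp add: h f_add)
    show "f (h (\<iota> c * a) $ i) = c * f (h a $ i)"
      using fU[OF h(1) kV.subspace_scale[OF U(1) h(1)], of "\<iota> c * a" c a i] i by (simp add: h f_scale)
  qed
  then obtain X where X: "\<And>i a. i \<noteq> i0 \<Longrightarrow> f (h a $ i) = f (a * X i)" by metis
  define x where "x = (\<chi> i. if i = i0 then 0 else X i)"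
  have "U = xpt f x"
  proof (intro antisym subsetI)
    fix y assume "y \<in> U"
    then show "y \<in> xpt f x"
      using fU[OF _ h(1), of y "y $ i0"] X h(2) by (auto simp: xpt_def x_def)
  next
    fix y assume y: "y \<in> xpt f x"
    have "h (y $ i0) \<in> xpt f x" using X h(2) by (auto simp: xpt_def x_def)
    then have "y - h (y $ i0) \<in> U" using xpt_diff_in_chi0[OF y] h(2) U(2) by auto
    then have "(y - h (y $ i0)) + h (y $ i0) \<in> U" using h(1) by (rule kV.subspace_add[OF U(1)])
    then show "y \<in> U" by simp
  qed
  moreover have "x $ i0 = 0" by (simp add: x_def)
  ultimately show ?thesis by blast
qed

text \<open>Adding to \<open>Z\<close> a vector \<open>u\<close> outside \<open>Z + S0\<close>
  yields a space \<open>U\<close> of the form \<open>xpt f x\<close>. In it, \<open>Z\<close> is the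
  kernel of a functional \<open>g\<close>, and \<open>g\<close> depends only on the entry at
  \<open>i0\<close>, again as \<open>f\<close> of a multiple.\<close>

lemma xln_characterization:
  assumes Z: "kV.subspace Z" "chi0 f \<subseteq> Z" "card (ssum Z S0) = q ^ (s * t + s + t)"
    "card Z = q ^ (s * t + s)"
  shows "\<exists>c x. c \<noteq> 0 \<and> x $ i0 = 0 \<and> Z = xln f c x"
proof -
  let ?M = "ssum Z S0"
  note M = kV.subspace_ssum[OF Z(1) subspace_S0]
  have "card ?M \<noteq> CARD('K ^ 'n)" unfolding Z(3) card_V q_power_eq_iff by simp
  then obtain u where u: "u \<notin> ?M" by (metis UNIV_eq_I)
  have uZ: "u \<notin> Z" using u kV.ssum_superset[OF Z(1) subspace_S0] by blast
  define U where "U = {z + \<iota> r *s u | z r. z \<in> Z}"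
  note ins = kV.subspace_insert_functional[OF Z(1) uZ, folded U_def]
  have ZU: "Z \<subseteq> U"
  proof
    fix z assume "z \<in> Z"
    then show "z \<in> U" unfolding U_def by (intro CollectI exI[of _ z] exI[of _ 0]) simp
  qed
  have uU: "u \<in> U"
    unfolding U_def using kV.subspace_0[OF Z(1)] by (intro CollectI exI[of _ 0] exI[of _ 1]) simp
  have cU: "card U = q ^ (s * t + s + 1)" using ins(2) Z(4) card_k by simp
  note US = kV.subspace_ssum[OF ins(1) subspace_S0]
  note sup = kV.ssum_superset[OF ins(1) subspace_S0]
  have "?M \<subseteq> ssum U S0" using ZU sup by (intro kV.ssum_least[OF US]) auto
  moreover have "u \<in> ssum U S0" using uU sup by blast
  ultimately have "?M \<subset> ssum U S0" using u by blast
  \<comment> \<open>\<open>?M\<close> has index \<open>q\<close>, so any strictly larger subspace is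
    everything.\<close>
  then have "q * card ?M \<le> card (ssum U S0)"
    using kV.card_subspace_psubset[OF M US] card_k by simp
  moreover have "q * card ?M = CARD('K ^ 'n)"
    unfolding Z(3) card_V power_Suc[symmetric] q_power_eq_iff by simp
  ultimately have "card (ssum U S0) = CARD('K ^ 'n)"
    using card_mono[of "UNIV :: ('K ^ 'n) set" "ssum U S0"] by simp
  then have "ssum U S0 = UNIV" by (intro card_subset_eq) auto
  then obtain x where x: "x $ i0 = 0" "U = xpt f x"
    using xpt_characterization[OF ins(1) _ _ cU] Z(2) ZU by blast
  obtain g where g: "\<forall>v\<in>U. \<forall>w\<in>U. g (v + w) = g v + g w" "\<forall>c. \<forall>v\<in>U. g (\<iota> c *s v) = c * g v"
    "\<forall>v\<in>U. g v = 0 \<longleftrightarrow> v \<in> Z" "g u = 1"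
    using ins(3) by blast
  let ?e = "\<lambda>a. a *s (axis i0 1 + x)"
  have eU: "?e a \<in> U" for a unfolding x(2) by (rule scaled_in_xpt[OF x(1)])
  have "\<exists>c. \<forall>a. g (?e a) = f (a * c)"
  proof (rule functional_repr)
    show "g (?e (a + b)) = g (?e a) + g (?e b)" for a b
      using g(1) eU[of a] eU[of b] by (simp only: vec.scale_left_distrib)
    show "g (?e (\<iota> c * a)) = c * g (?e a)" for c a
      using g(2) eU[of a] by (simp only: vec.scale_scale[symmetric])
  qed
  then obtain c where c: "\<And>a. g (?e a) = f (a * c)" by blast
  \<comment> \<open>Modulo \<open>chi0 f\<close>, where \<open>g\<close> vanishes, \<open>y\<close>
    equals the multiple of \<open>axis i0 1 + x\<close> with the same entry at
    \<open>i0\<close>.\<close>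
  have gy: "g y = f (y $ i0 * c)" if y: "y \<in> U" for y
  proof -
    have "y - ?e (y $ i0) \<in> chi0 f"
      using xpt_diff_in_chi0[of y x "?e (y $ i0)"] y eU[of "y $ i0"] x by simp
    then have yZ: "y - ?e (y $ i0) \<in> Z" using Z(2) by blast
    then have "g (y - ?e (y $ i0)) = 0" using g(3) ZU by blast
    moreover have "g ((y - ?e (y $ i0)) + ?e (y $ i0)) = g (y - ?e (y $ i0)) + g (?e (y $ i0))"
      using g(1) yZ ZU eU[of "y $ i0"] by blast
    ultimately show ?thesis using c by simp
  qed
  have "c \<noteq> 0" using gy[OF uU] g(4) by auto
  moreover have "Z = xln f c x"
  proof (intro antisym subsetI)
    fix y assume y: "y \<in> Z"
    then have "g y = 0" "y \<in> U" using g(3) ZU by auto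
    then show "y \<in> xln f c x" using gy[of y] x(2) by (simp add: xln_def mult.commute)
  next
    fix y assume "y \<in> xln f c x"
    then have "y \<in> U" "f (y $ i0 * c) = 0" using x(2) by (auto simp: xln_def mult.commute)
    then show "y \<in> Z" using gy g(3) by simp
  qed
  ultimately show ?thesis using x(1) by blast
qed

text \<open>The inclusion says that \<open>f (c * a) = 0\<close> implies
  \<open>f (a * (x' $ i - x $ i)) = 0\<close> for all \<open>i\<close>. Functionals with nested
  kernels are proportional with a factor in \<open>'k\<close>, and by nondegeneracy
  \<open>x' $ i - x $ i\<close> is \<open>c\<close> times this factor.\<close>

lemma xln_subset_xpt_iff:
  assumes c: "c \<noteq> 0" and x: "x $ i0 = 0" and x': "x' $ i0 = 0"
  shows "xln f c x \<subseteq> xpt f x' \<longleftrightarrow> (\<exists>w. w $ i0 = 0 \<and> x' = x + c *s emb \<iota> w)"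
proof
  assume "\<exists>w. w $ i0 = 0 \<and> x' = x + c *s emb \<iota> w"
  then obtain w where w: "x' = x + c *s emb \<iota> w" by blast
  have "f (y0 * x' $ i) = f (y0 * x $ i)" if "f (c * y0) = 0" for y0 i
  proof -
    have "y0 * x' $ i = y0 * x $ i + \<iota> (w $ i) * (c * y0)" using w by (simp add: algebra_simps)
    then show ?thesis using that by (simp add: f_add f_scale)
  qed
  then show "xln f c x \<subseteq> xpt f x'" by (auto simp: xln_def xpt_def)
next
  assume sub: "xln f c x \<subseteq> xpt f x'"
  have ker: "f (a * (x' $ i - x $ i)) = 0" if "f (c * a) = 0" for a i
  proof (cases "i = i0")
    case False
    have "a *s (axis i0 1 + x) \<in> xln f c x"
      using scaled_in_xpt[OF x] that x by (simp add: xln_def)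
    then have "a *s (axis i0 1 + x) \<in> xpt f x'" using sub by blast
    then have "f (a * x $ i) = f (a * x' $ i)" using False x by (simp add: xpt_def axis_def)
    then show ?thesis by (simp add: right_diff_distrib f_diff)
  qed (use x x' in simp)
  obtain a0 where a0: "f a0 = 1" by (rule obtain_f_1)
  \<comment> \<open>Normalised so that \<open>f (c * a1) = 1\<close>. The factor of proportionality
    is then the value of the second functional at \<open>a1\<close>, which is how \<open>w\<close>
    is defined.\<close>
  define a1 where "a1 = a0 / c"
  have a1: "f (c * a1) = 1" using a0 c by (simp add: a1_def)
  define w where "w = (\<chi> i. f (a1 * (x' $ i - x $ i)))"
  have "x' $ i - x $ i = c * \<iota> (w $ i)" for i
  proof (rule f_mult_eqD)
    fix a
    let ?d = "x' $ i - x $ i"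
    have "f (c * (a - \<iota> (f (c * a)) * a1)) = 0"
      using a1 by (simp add: right_diff_distrib f_diff f_scale mult.left_commute[of c])
    then have "f ((a - \<iota> (f (c * a)) * a1) * ?d) = 0" by (rule ker)
    then have "f (a * ?d) = f (c * a) * f (a1 * ?d)"
      by (simp add: left_diff_distrib[of a] f_diff mult.assoc f_scale del: right_diff_distrib)
    also have "\<dots> = f (a * (c * \<iota> (w $ i)))"
      using f_scale[of "w $ i" "c * a"] by (simp add: w_def mult_ac)
    finally show "f (a * ?d) = f (a * (c * \<iota> (w $ i)))" .
  qed
  then have "x' = x + c *s emb \<iota> w" by (simp add: vec_eq_iff diff_eq_eq add.commute)
  moreover have "w $ i0 = 0" using x x' by (simp add: w_def)
  ultimately show "\<exists>w. w $ i0 = 0 \<and> x' = x + c *s emb \<iota> w" by blast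
qed

lemma inj_xpt:
  assumes "x $ i0 = 0" "x' $ i0 = 0" "xpt f x = xpt f x'"
  shows "x = x'"
proof -
  have "x $ i = x' $ i" for i
  proof (cases "i = i0")
    case False
    show ?thesis
    proof (rule f_mult_eqD)
      fix a
      have "a *s (axis i0 1 + x) \<in> xpt f x'" using scaled_in_xpt[OF assms(1)] assms(3) by simp
      then show "f (a * x $ i) = f (a * x' $ i)"
        using False assms(1) by (simp add: xpt_def axis_def)
    qed
  qed (use assms in simp)
  then show ?thesis by (simp add: vec_eq_iff)
qed

text \<open>Dually, a line of \<open>X\<close> is spanned by its points. Two of them suffice:
  membership for \<open>x\<close> and for \<open>x + c *s axis j 1\<close> differs exactly by the
  condition \<open>f (c * y $ i0) = 0\<close>.\<close>

lemma xln_eq_Inter: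
  assumes c: "c \<noteq> 0" and x: "x $ i0 = 0"
  shows "xln f c x = \<Inter> {xpt f x' | x'. x' $ i0 = 0 \<and> xln f c x \<subseteq> xpt f x'}"
proof (intro antisym subsetI)
  fix y assume y: "y \<in> \<Inter> {xpt f x' | x'. x' $ i0 = 0 \<and> xln f c x \<subseteq> xpt f x'}"
  have yw: "y \<in> xpt f (x + c *s emb \<iota> w)" if "w $ i0 = 0" for w
  proof -
    have "(x + c *s emb \<iota> w) $ i0 = 0" using x that by simp
    moreover from this have "xln f c x \<subseteq> xpt f (x + c *s emb \<iota> w)"
      using xln_subset_xpt_iff[OF c x] that by blast
    ultimately show ?thesis using y by blast
  qed
  have "card (UNIV - {i0}) = t" using card_n by simp
  then have "UNIV - {i0} \<noteq> {}" using t by (metis card.empty)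
  then obtain j where j: "j \<noteq> i0" by blast
  have y0: "y \<in> xpt f x" using yw[of 0] by simp
  have "axis j (1::'k) $ i0 = 0" using j by (simp add: axis_def)
  from yw[OF this] have "f (y $ j) = f (y $ i0 * (x $ j + c))"
    using j by (simp add: xpt_def axis_def)
  moreover have "f (y $ j) = f (y $ i0 * x $ j)" using y0 j by (simp add: xpt_def)
  ultimately have "f (c * y $ i0) = 0" by (simp add: distrib_left f_add mult.commute)
  then show "y \<in> xln f c x" using y0 by (simp add: xln_def)
qed blast

text \<open>The entries of \<open>w\<close> lie in \<open>'k\<close> and pass through
  \<open>f\<close>, so \<open>a *s emb \<iota> w\<close> belongs to \<open>chi0 f\<close> exactly
  when \<open>f a = 0\<close>.\<close>

lemma chi0_inter_line:
  assumes w: "w $ i0 = 0" "w \<noteq> 0"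
  shows "card (chi0 f \<inter> range (\<lambda>a. a *s emb \<iota> w)) = q ^ s"
proof -
  obtain j where j: "w $ j \<noteq> 0" using w(2) by (auto simp: vec_eq_iff)
  have "a *s emb \<iota> w \<in> chi0 f \<longleftrightarrow> f a = 0" for a
  proof
    assume "a *s emb \<iota> w \<in> chi0 f"
    moreover have "j \<noteq> i0" using j w(1) by auto
    ultimately have "f (\<iota> (w $ j) * a) = 0" by (simp add: chi0_def mult.commute)
    then show "f a = 0" using j by (simp add: f_scale)
  next
    assume "f a = 0"
    then have "f (\<iota> (w $ i) * a) = 0" for i by (simp add: f_scale)
    then show "a *s emb \<iota> w \<in> chi0 f" using w(1) by (simp add: chi0_def mult.commute)
  qed
  then have "chi0 f \<inter> range (\<lambda>a. a *s emb \<iota> w) = (\<lambda>a. a *s emb \<iota> w) ` {a. f a = 0}" by auto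
  moreover have "inj_on (\<lambda>a. a *s emb \<iota> w) {a. f a = 0}"
  proof (rule inj_onI)
    fix a b assume "a *s emb \<iota> w = b *s emb \<iota> w"
    then show "a = b" using w(2) by simp
  qed
  ultimately show ?thesis using card_ker by (simp add: card_image)
qed

end

section \<open>Admissible spaces in coordinates\<close>

context field_extension begin

text \<open>
  \<open>H w\<close> is the kernel and \<open>J w / X\<close> the image of the rank one map \<open>a \<mapsto> a w\<close> from \<open>'K\<close> to \<open>S0 / X\<close>. If
  two kernels differ, all images coincide, and \<open>S0 / X\<close> would be one-dimensional.
\<close>

lemma chi0_characterization:
  assumes X: "kV.subspace X" "X \<subseteq> S0" "card X = q ^ (s * t)"
    and line: "\<And>w :: 'k ^ 'n. w $ i0 = 0 \<Longrightarrow> w \<noteq> 0 \<Longrightarrow> card (X \<inter> range (\<lambda>a. a *s emb \<iota> w)) = q ^ s"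
  shows "\<exists>f. functional f \<and> X = chi0 f"
proof -
  define E where "E w = range (\<lambda>a. a *s emb \<iota> w)" for w :: "'k ^ 'n"
  define H where "H w = {a. a *s emb \<iota> w \<in> X}" for w :: "'k ^ 'n"
  have subE: "kV.subspace (E w)" for w
    unfolding E_def by (rule subspace_line)
  have subH: "kK.subspace (H w)" for w
  proof (rule kK.subspaceI)
    show "0 \<in> H w" unfolding H_def using kV.subspace_0[OF X(1)] by simp
    show "a + b \<in> H w" if "a \<in> H w" "b \<in> H w" for a b
      using that kV.subspace_add[OF X(1)] by (simp add: H_def vec.scale_left_distrib)
    show "\<iota> c * a \<in> H w" if "a \<in> H w" for c a
      using that kV.subspace_scale[OF X(1), of "a *s emb \<iota> w" c] by (simp add: H_def)
  qed
  have injE: "inj (\<lambda>a. a *s emb \<iota> w)" if "w \<noteq> 0" for w :: "'k ^ 'n"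
    using that by (auto intro!: injI)
  have cardE: "card (E w) = q ^ (s + 1)" if "w \<noteq> 0" for w
    unfolding E_def using card_image[OF injE[OF that]] card_K by simp
  have cardH: "card (H w) = q ^ s" if w: "w $ i0 = 0" "w \<noteq> 0" for w
  proof -
    have "(\<lambda>a. a *s emb \<iota> w) ` H w = X \<inter> range (\<lambda>a. a *s emb \<iota> w)" by (auto simp: H_def)
    then have "card ((\<lambda>a. a *s emb \<iota> w) ` H w) = q ^ s" using line[OF w] by simp
    then show ?thesis using card_image[OF inj_on_subset[OF injE[OF w(2)] subset_UNIV], of "H w"] by simp
  qed
  define J where "J w = ssum X (E w)" for w
  have subJ: "kV.subspace (J w)" for w
    unfolding J_def by (rule kV.subspace_ssum[OF X(1) subE])
  have XJ: "X \<subseteq> J w" and EJ: "E w \<subseteq> J w" for w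
    unfolding J_def using kV.ssum_superset[OF X(1) subE] by auto
  have cardJ: "card (J w) = q ^ (s * t + 1)" if w: "w $ i0 = 0" "w \<noteq> 0" for w
  proof -
    have "card (J w) * q ^ s = q ^ (s * t) * q ^ (s + 1)"
      using kV.card_ssum[OF X(1) subE, of w] line[OF w] cardE[OF w(2)] X(3) by (simp add: J_def E_def)
    also have "\<dots> = q ^ (s * t + 1) * q ^ s" by (simp add: power_add)
    finally show ?thesis using q_gt_1 by simp
  qed
  \<comment> \<open>Modulo \<open>X\<close>, the vectors \<open>a *s emb \<iota> (w + w')\<close>
    and \<open>a *s emb \<iota> w'\<close> agree and are nonzero. The images \<open>J w'\<close> and
    \<open>J (w + w')\<close>, each one-dimensional modulo \<open>X\<close>, therefore
    coincide.\<close>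
  have Jeq: "J w' = J (w + w')"
    if w: "w $ i0 = 0" and w': "w' $ i0 = 0" "w' \<noteq> 0" and ww: "w + w' \<noteq> 0" and a: "a \<in> H w" "a \<notin> H w'" for w w' a
  proof -
    let ?I = "J w' \<inter> J (w + w')"
    have ww0: "(w + w') $ i0 = 0" using w w' by simp
    have "a *s emb \<iota> w' \<in> J w'" using EJ[of w'] by (auto simp: E_def)
    moreover have "a *s emb \<iota> (w + w') - a *s emb \<iota> w \<in> J (w + w')"
    proof (rule kV.subspace_diff[OF subJ])
      show "a *s emb \<iota> (w + w') \<in> J (w + w')" using EJ[of "w + w'"] by (auto simp: E_def)
      show "a *s emb \<iota> w \<in> J (w + w')" using XJ[of "w + w'"] a(1) by (auto simp: H_def)
    qed
    then have "a *s emb \<iota> w' \<in> J (w + w')" by (simp add: emb_add vec.scale_right_distrib)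
    ultimately have "a *s emb \<iota> w' \<in> ?I" by blast
    moreover have "a *s emb \<iota> w' \<notin> X" using a(2) by (simp add: H_def)
    moreover have "X \<subseteq> ?I" using XJ by blast
    ultimately have "X \<subset> ?I" by blast
    then have "q * q ^ (s * t) \<le> card ?I"
      using kV.card_subspace_psubset[OF X(1) kV.subspace_inter[OF subJ subJ]] card_k X(3) by metis
    then have "card (J w') \<le> card ?I" "card (J (w + w')) \<le> card ?I"
      using cardJ[OF w'] cardJ[OF ww0 ww] by simp_all
    then have "?I = J w'" "?I = J (w + w')"
      by (intro card_seteq; simp)+
    then show ?thesis by simp
  qed
  have ax: "axis i (1::'k) $ i0 = 0" "axis i (1::'k) \<noteq> 0" if "i \<noteq> i0" for i
    using that by (auto simp: axis_def vec_eq_iff)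
  define h where "h i = H (axis i (1::'k))" for i
  define jj where "jj i = J (axis i (1::'k))" for i
  have differ: "jj i = jj j" if ij: "i \<noteq> i0" "j \<noteq> i0" "h i \<noteq> h j" for i j
  proof -
    have "i \<noteq> j" using ij by blast
    then have "(axis i (1::'k) + axis j 1) $ i \<noteq> 0" by (simp add: axis_def)
    then have ne: "axis i (1::'k) + axis j 1 \<noteq> 0" by (metis zero_index)
    \<comment> \<open>Kernels of equal size that differ are incomparable. This allows
      \<open>Jeq\<close> to be used in both directions, with the image of the sum as the common
      value.\<close>
    have "card (h i) = card (h j)" unfolding h_def using cardH ax ij by simp
    then have "\<not> h i \<subseteq> h j" "\<not> h j \<subseteq> h i"
      using ij(3) card_subset_eq[of "h j" "h i"] card_subset_eq[of "h i" "h j"] by auto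
    then obtain a b where ab: "a \<in> h i" "a \<notin> h j" "b \<in> h j" "b \<notin> h i" by blast
    have "jj j = J (axis i 1 + axis j 1)"
      unfolding jj_def using Jeq[OF ax(1)[OF ij(1)] ax[OF ij(2)] ne] ab by (simp add: h_def)
    moreover have "jj i = J (axis j 1 + axis i 1)"
      unfolding jj_def using Jeq[OF ax(1)[OF ij(2)] ax[OF ij(1)]] ne ab by (simp add: h_def add.commute)
    ultimately show ?thesis by (simp add: add.commute)
  qed
  have expand: "y = (\<Sum>i\<in>UNIV - {i0}. y $ i *s axis i 1)" if "y \<in> S0" for y
  proof -
    have "y = (\<Sum>i\<in>UNIV. y $ i *s axis i 1)" by (simp add: basis_expansion)
    also have "\<dots> = (\<Sum>i\<in>UNIV - {i0}. y $ i *s axis i 1)"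
      using that by (intro sum.mono_neutral_right) (auto simp: S0_def)
    finally show ?thesis .
  qed
  have same: "h i = h j" if ij: "i \<noteq> i0" "j \<noteq> i0" for i j
  proof (rule ccontr)
    assume ne: "h i \<noteq> h j"
    \<comment> \<open>Any third kernel differs from at least one of the two different kernels
      \<open>h i\<close> and \<open>h j\<close>.\<close>
    have all: "jj l = jj i" if "l \<noteq> i0" for l
      using differ[OF that ij(1)] differ[OF that ij(2)] differ[OF ij ne] ne by metis
    have "S0 \<subseteq> jj i"
    proof
      fix y assume "y \<in> S0"
      then have "y = (\<Sum>i\<in>UNIV - {i0}. y $ i *s axis i 1)" by (rule expand)
      also have "\<dots> \<in> jj i"
      proof (rule kV.subspace_sum)
        show "kV.subspace (jj i)" unfolding jj_def by (rule subJ)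
        fix l assume "l \<in> UNIV - {i0}"
        then have "jj i = J (axis l 1)" using all by (simp add: jj_def)
        then show "y $ l *s axis l 1 \<in> jj i" using EJ[of "axis l 1"] by (auto simp: E_def)
      qed
      finally show "y \<in> jj i" .
    qed
    then have "card S0 \<le> card (jj i)" by (intro card_mono) auto
    then have "q ^ ((s + 1) * t) \<le> q ^ (s * t + 1)"
      using card_S0 cardJ[OF ax[OF ij(1)]] by (simp add: jj_def)
    then have "(s + 1) * t \<le> s * t + 1" using q_gt_1 power_le_imp_le_exp by blast
    \<comment> \<open>This contradicts the presence of two distinct coordinates \<open>i\<close> and
      \<open>j\<close> other than \<open>i0\<close>.\<close>
    then have "t \<le> 1" by simp
    moreover have "card {i, j} \<le> card (UNIV - {i0})" using ij by (intro card_mono) auto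
    moreover have "i \<noteq> j" using ne by blast
    ultimately show False using card_n by simp
  qed
  have "card (UNIV - {i0}) = t" using card_n by simp
  then have "UNIV - {i0} \<noteq> {}" using t by (metis card.empty)
  then obtain j where j: "j \<noteq> i0" by blast
  have cj: "card (h j) = q ^ s" unfolding h_def by (rule cardH[OF ax[OF j]])
  have sj: "kK.subspace (h j)" unfolding h_def by (rule subH)
  have "card (h j) \<noteq> CARD('K)" unfolding cj card_K q_power_eq_iff by simp
  then obtain u where u: "u \<notin> h j" by (metis UNIV_eq_I)
  \<comment> \<open>The common kernel \<open>h j\<close> has index \<open>q\<close> in
    \<open>'K\<close>, so one further vector generates the field. The coefficient of that vector is
    the desired \<open>f\<close>.\<close>
  define U where "U = {z + \<iota> r * u | z r. z \<in> h j}"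
  note ins = kK.subspace_insert_functional[OF sj u, folded U_def]
  have "card U = CARD('K)" using ins(2) cj card_K card_k by simp
  then have U: "U = UNIV" by (intro card_subset_eq) auto
  obtain f where f: "\<forall>v\<in>U. \<forall>w\<in>U. f (v + w) = f v + f w" "\<forall>c. \<forall>v\<in>U. f (\<iota> c * v) = c * f v"
    "\<forall>v\<in>U. f v = 0 \<longleftrightarrow> v \<in> h j" "f u = 1"
    using ins(3) by blast
  have fn: "functional f"
    unfolding functional_def using f U by (metis UNIV_I zero_neq_one)
  interpret wf: extension_functional \<iota> i0 s t q f by unfold_locales (rule fn)
  have "chi0 f \<subseteq> X"
  proof
    fix y assume y: "y \<in> chi0 f"
    then have "y \<in> S0" using wf.chi0_subset_S0 by blast
    then have "y = (\<Sum>i\<in>UNIV - {i0}. y $ i *s axis i 1)" by (rule expand)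
    also have "\<dots> \<in> X"
    proof (rule kV.subspace_sum[OF X(1)])
      fix l assume l: "l \<in> UNIV - {i0}"
      then have "f (y $ l) = 0" using y by (simp add: chi0_def)
      then have "y $ l \<in> h j" using f(3) U by blast
      then have "y $ l \<in> h l" using same[of l j] l j by simp
      then show "y $ l *s axis l 1 \<in> X" by (simp add: h_def H_def)
    qed
    finally show "y \<in> X" .
  qed
  then have "chi0 f = X" using X(3) wf.card_chi0 by (intro card_subset_eq) auto
  then show ?thesis using fn by blast
qed

end

section \<open>Dualities\<close>

text \<open>
  Reversing pairs \<open>U \<subseteq> W\<close> is an injective map of a finite set into itself, so the inverse of a
  duality is order-reversing as well.
\<close>

lemma duality_subset_iff:
  fixes d :: "('a::{field,finite} ^ 'm) set \<Rightarrow> ('a ^ 'm) set"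
  assumes d: "duality N d" and "vec.subspace U" "vec.subspace W"
  shows "d W \<subseteq> d U \<longleftrightarrow> U \<subseteq> W"
proof
  show "d W \<subseteq> d U" if "U \<subseteq> W"
    using d assms(2,3) that unfolding duality_def by blast
next
  assume le: "d W \<subseteq> d U"
  have bij: "bij_betw d {U. vec.subspace U} {U. vec.subspace U}"
    and anti: "\<And>U W. vec.subspace U \<Longrightarrow> vec.subspace W \<Longrightarrow> U \<subseteq> W \<Longrightarrow> d W \<subseteq> d U"
    using d unfolding duality_def by blast+
  have inj: "U = W" if "vec.subspace U" "vec.subspace W" "d U = d W" for U W
    using bij that by (auto simp: bij_betw_def inj_on_def)
  have im: "vec.subspace (d U)" if "vec.subspace U" for U
    using bij that by (auto simp: bij_betw_def)
  define R where "R = {p :: ('a ^ 'm) set \<times> ('a ^ 'm) set.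
    vec.subspace (fst p) \<and> vec.subspace (snd p) \<and> fst p \<subseteq> snd p}"
  define h where "h p = (d (snd p), d (fst p))" for p :: "('a ^ 'm) set \<times> ('a ^ 'm) set"
  have "h ` R \<subseteq> R"
  proof (rule image_subsetI)
    fix p assume "p \<in> R"
    then show "h p \<in> R" using im anti[of "fst p" "snd p"] by (simp add: R_def h_def)
  qed
  moreover have "inj_on h R"
  proof (rule inj_onI)
    fix p p' assume "p \<in> R" "p' \<in> R" "h p = h p'"
    then show "p = p'"
      using inj[of "fst p" "fst p'"] inj[of "snd p" "snd p'"] by (simp add: R_def h_def prod_eq_iff)
  qed
  ultimately have "h ` R = R" by (intro endo_inj_surj) auto
  moreover have "(d W, d U) \<in> R" using le im assms by (simp add: R_def)
  ultimately obtain p where p: "p \<in> R" "(d W, d U) = h p" by blast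
  have "fst p = U" "snd p = W"
    using p assms inj[of "fst p" U] inj[of "snd p" W] by (simp_all add: R_def h_def)
  then show "U \<subseteq> W" using p(1) by (simp add: R_def)
qed

lemma pspace_unique: "pspace a U \<Longrightarrow> pspace b U \<Longrightarrow> a = b"
  by (simp add: pspace_def)

text \<open>The line map is read off from the sets of points: injectivity of \<open>f\<close> makes
  it injective, and \<open>uniq\<close> makes it onto, since a target line is known by the points on
  it.\<close>

lemma geometry_isoI:
  assumes bij: "bij_betw f P P'"
    and sub: "\<And>L. L \<in> Ls \<Longrightarrow> L \<subseteq> P"
    and ex1: "\<And>L. L \<in> Ls \<Longrightarrow> \<exists>M\<in>Ms. f ` L = {R \<in> P'. R \<subseteq> M}"
    and ex2: "\<And>M. M \<in> Ms \<Longrightarrow> \<exists>L\<in>Ls. f ` L = {R \<in> P'. R \<subseteq> M}"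
    and uniq: "\<And>M M'. M \<in> Ms \<Longrightarrow> M' \<in> Ms \<Longrightarrow> {R \<in> P'. R \<subseteq> M} = {R \<in> P'. R \<subseteq> M'} \<Longrightarrow> M = M'"
  shows "geometry_iso f P Ls (\<in>) P' Ms (\<subseteq>)"
proof -
  obtain g where g: "\<And>L. L \<in> Ls \<Longrightarrow> g L \<in> Ms \<and> f ` L = {R \<in> P'. R \<subseteq> g L}"
    using ex1 by metis
  have inj: "inj_on f P" using bij by (simp add: bij_betw_def)
  have "bij_betw g Ls Ms"
    unfolding bij_betw_def
  proof
    show "inj_on g Ls"
    proof (rule inj_onI)
      fix L L' assume L: "L \<in> Ls" "L' \<in> Ls" "g L = g L'"
      then have "f ` L = f ` L'" using g[OF L(1)] g[OF L(2)] by simp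
      then show "L = L'" using inj_on_image_eq_iff[OF inj sub[OF L(1)] sub[OF L(2)]] by simp
    qed
    show "g ` Ls = Ms"
    proof
      show "g ` Ls \<subseteq> Ms" using g by blast
      show "Ms \<subseteq> g ` Ls"
      proof
        fix M assume M: "M \<in> Ms"
        obtain L where L: "L \<in> Ls" "f ` L = {R \<in> P'. R \<subseteq> M}"
          using ex2[OF M] by (elim bexE) (rule that)
        then have "{R \<in> P'. R \<subseteq> g L} = {R \<in> P'. R \<subseteq> M}" using g[OF L(1)] by simp
        then have "g L = M" using uniq[of "g L" M] g[OF L(1)] M by simp
        then show "M \<in> g ` Ls" using L by blast
      qed
    qed
  qed
  moreover have "\<forall>p\<in>P. \<forall>l\<in>Ls. p \<in> l \<longleftrightarrow> f p \<subseteq> g l"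
  proof (intro ballI)
    fix p l assume that: "p \<in> P" "l \<in> Ls"
    have "p \<in> l \<longleftrightarrow> f p \<in> f ` l" using inj_on_image_mem_iff[OF inj that(1) sub[OF that(2)]] by simp
    also have "\<dots> \<longleftrightarrow> f p \<subseteq> g l"
      using g[OF that(2)] bij that(1) by (auto simp: bij_betw_def)
    finally show "p \<in> l \<longleftrightarrow> f p \<subseteq> g l" .
  qed
  ultimately show ?thesis
    unfolding geometry_iso_def by (intro conjI bij exI[of _ g])
qed

section \<open>Field reduction followed by the duality\<close>

locale reduction_duality = field_extension \<iota> i0 s t q + hyperplane_coords \<iota> T i0 \<Sigma> C t
  for \<iota> :: "'k::{field,finite} \<Rightarrow> 'K::{field,finite}" and i0 :: "'n::finite" and s t q :: nat
    and T :: "'K ^ 'n \<Rightarrow> 'K ^ 'n" and \<Sigma> :: "('K ^ 'n) set" and C :: "('K ^ 'n) set set" +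
  fixes \<psi> :: "'K ^ 'n \<Rightarrow> 'k ^ 'm" and d :: "('k ^ 'm) set \<Rightarrow> ('k ^ 'm) set"
  assumes psi: "linear_iso_over \<iota> \<psi>"
    and dual: "duality (int s * int t + int s + int t) d"
begin

definition \<Psi> :: "'K ^ 'n \<Rightarrow> 'k ^ 'm" where "\<Psi> v = \<psi> (T v)"

text \<open>An anti-isomorphism from the lattice of \<open>'k\<close>-subspaces of
  \<open>'K ^ 'n\<close> onto the subspaces of \<open>'k ^ 'm\<close>. Questions about
  \<open>X\<close> are pulled back along it to coordinates.\<close>

definition D :: "('K ^ 'n) set \<Rightarrow> ('k ^ 'm) set" where "D W = d (\<Psi> ` W)"

lemma psi_linear: "module_hom (\<lambda>c v. \<iota> c *s v) (*s) \<psi>"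
  using psi by (simp add: linear_iso_over_def module_hom_iff_linear)

lemma Psi_add: "\<Psi> (v + w) = \<Psi> v + \<Psi> w" and Psi_scale: "\<Psi> (\<iota> c *s v) = c *s \<Psi> v"
  using module_hom.add[OF psi_linear] module_hom.scale[OF psi_linear] by (simp_all add: \<Psi>_def T_simps)

lemma Psi_0 [simp]: "\<Psi> 0 = 0"
  using Psi_add[of 0 0] by simp

lemma bij_Psi: "bij \<Psi>"
proof -
  have "\<Psi> = \<psi> \<circ> T" by (auto simp: \<Psi>_def)
  then show ?thesis using bij psi by (simp add: linear_iso_over_def bij_comp)
qed

lemma inj_Psi: "inj \<Psi>" using bij_Psi by (rule bij_is_inj)

lemma card_Psi: "card (\<Psi> ` W) = card W"
  by (rule card_image) (rule inj_on_subset[OF inj_Psi subset_UNIV])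

lemma Psi_subset_iff: "\<Psi> ` A \<subseteq> \<Psi> ` B \<longleftrightarrow> A \<subseteq> B"
  by (rule inj_image_subset_iff[OF inj_Psi])

lemma subspace_Psi_iff: "vec.subspace (\<Psi> ` W) \<longleftrightarrow> kV.subspace W"
proof -
  have mem: "\<Psi> v \<in> \<Psi> ` W \<longleftrightarrow> v \<in> W" for v by (rule inj_image_mem_iff[OF inj_Psi])
  show ?thesis
  proof
    assume W: "vec.subspace (\<Psi> ` W)"
    show "kV.subspace W"
    proof (rule kV.subspaceI)
      show "0 \<in> W" using vec.subspace_0[OF W] mem[of 0] by simp
      show "x + y \<in> W" if "x \<in> W" "y \<in> W" for x y
        using vec.subspace_add[OF W, of "\<Psi> x" "\<Psi> y"] that mem by (simp flip: Psi_add)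
      show "\<iota> c *s x \<in> W" if "x \<in> W" for c x
        using vec.subspace_scale[OF W, of "\<Psi> x" c] that mem by (simp flip: Psi_scale)
    qed
  next
    assume W: "kV.subspace W"
    show "vec.subspace (\<Psi> ` W)"
    proof (rule vec.subspaceI)
      show "0 \<in> \<Psi> ` W" using kV.subspace_0[OF W] mem[of 0] by simp
      show "x + y \<in> \<Psi> ` W" if "x \<in> \<Psi> ` W" "y \<in> \<Psi> ` W" for x y
        using that kV.subspace_add[OF W] by (auto simp flip: Psi_add)
      show "c *s x \<in> \<Psi> ` W" if "x \<in> \<Psi> ` W" for c x
        using that kV.subspace_scale[OF W] by (auto simp flip: Psi_scale)
    qed
  qed
qed

lemma Psi_S0: "\<Psi> ` S0 = \<psi> ` \<Sigma>"
  by (simp add: \<Psi>_def image_image S0_def flip: T_hyperplane)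

lemma d_bij: "bij_betw d {U. vec.subspace U} {U. vec.subspace U}"
  using dual by (simp add: duality_def)

lemma subspace_D: "kV.subspace W \<Longrightarrow> vec.subspace (D W)"
  unfolding D_def using d_bij subspace_Psi_iff by (auto simp: bij_betw_def)

lemma D_surj:
  assumes "vec.subspace R"
  obtains W where "kV.subspace W" "R = D W"
proof -
  obtain V where V: "vec.subspace V" "R = d V"
    using d_bij assms by (auto simp: bij_betw_def)
  obtain W where W: "V = \<Psi> ` W" using bij_Psi by (metis bij_is_surj surj_image_vimage_eq)
  show ?thesis by (rule that[of W]) (use V W subspace_Psi_iff in \<open>auto simp: D_def\<close>)
qed

lemma D_subset_iff: "kV.subspace A \<Longrightarrow> kV.subspace B \<Longrightarrow> D A \<subseteq> D B \<longleftrightarrow> B \<subseteq> A"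
  unfolding D_def using duality_subset_iff[OF dual] subspace_Psi_iff Psi_subset_iff by simp

lemma D_eq_iff: "kV.subspace A \<Longrightarrow> kV.subspace B \<Longrightarrow> D A = D B \<longleftrightarrow> A = B"
  using D_subset_iff[of A B] D_subset_iff[of B A] by blast

text \<open>Order reversal exchanges joins and meets. The intersection is itself some
  \<open>D V\<close>, and \<open>V\<close> contains both spaces, hence their sum.\<close>

lemma D_inter:
  assumes A: "kV.subspace A" and B: "kV.subspace B"
  shows "D A \<inter> D B = D (ssum A B)"
proof
  note AB = kV.subspace_ssum[OF A B]
  show "D (ssum A B) \<subseteq> D A \<inter> D B"
    using D_subset_iff[OF AB A] D_subset_iff[OF AB B] kV.ssum_superset[OF A B] by simp
  obtain V where V: "kV.subspace V" "D A \<inter> D B = D V"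
    using D_surj[OF vec.subspace_inter[OF subspace_D[OF A] subspace_D[OF B]]] by blast
  then have "A \<subseteq> V" "B \<subseteq> V" using D_subset_iff[OF V(1) A] D_subset_iff[OF V(1) B] by auto
  then have "ssum A B \<subseteq> V" by (rule kV.ssum_least[OF V(1)])
  then show "D A \<inter> D B \<subseteq> D (ssum A B)" using V D_subset_iff[OF V(1) AB] by simp
qed

text \<open>A space of vector dimension \<open>r\<close> is a projective
  \<open>(r - 1)\<close>-space, so its dual has projective dimension
  \<open>s * t + s + t - r\<close>.\<close>

lemma pspace_D_iff:
  assumes W: "kV.subspace W" and j: "j + int r = int s * int t + int s + int t"
  shows "pspace j (D W) \<longleftrightarrow> card W = q ^ r"
proof -
  have V: "vec.subspace (\<Psi> ` W)" using W subspace_Psi_iff by simp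
  define e where "e = vec.dim (\<Psi> ` W)"
  have "card W = q ^ e"
    using vec.card_subspace[OF V] card_Psi card_k by (simp add: e_def)
  then have ce: "card W = q ^ r \<longleftrightarrow> e = r" by simp
  have "pspace (int e - 1) (\<Psi> ` W)" using V by (simp add: pspace_def e_def)
  then have pe: "pspace (int s * int t + int s + int t - 1 - (int e - 1)) (D W)"
    unfolding D_def using dual unfolding duality_def by blast
  show ?thesis
  proof
    assume "pspace j (D W)"
    then have "j = int s * int t + int s + int t - 1 - (int e - 1)" using pe by (rule pspace_unique)
    then show "card W = q ^ r" using j ce by simp
  next
    assume "card W = q ^ r"
    then have "j = int s * int t + int s + int t - 1 - (int e - 1)" using j ce by simp
    then show "pspace j (D W)" using pe by (simp only:)
  qed
qed

lemma D_UNIV: "D UNIV = {0}"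
proof -
  \<comment> \<open>The full vector dimension \<open>(s + 1) * (t + 1)\<close> exceeds
    \<open>s * t + s + t\<close> by one, which gives the empty space.\<close>
  have "pspace (-1) (D UNIV) \<longleftrightarrow> CARD('K ^ 'n) = q ^ ((s + 1) * (t + 1))"
    by (rule pspace_D_iff) (simp_all add: algebra_simps)
  then have "vec.subspace (D UNIV)" "vec.dim (D UNIV) = 0" using card_V by (auto simp: pspace_def)
  then show ?thesis using vec.dim_eq_0[of "D UNIV"] vec.subspace_0 by blast
qed

text \<open>Through \<open>\<Psi>\<close> the points of \<open>C\<close> become the
  \<open>'K\<close>-lines of rational vectors, and the dimension conditions become cardinalities.
  The two directions are then \<open>chi0_characterization\<close> and
  \<open>chi0_inter_line\<close>.\<close>

lemma admissible_chi_iff: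
  "admissible_chi s t \<psi> \<Sigma> C chi \<longleftrightarrow> (\<exists>f. functional f \<and> chi = \<Psi> ` chi0 f)"
proof -
  have spanT: "\<psi> ` vec.span {T (emb \<iota> w)} = \<Psi> ` range (\<lambda>a. a *s emb \<iota> w)" for w
    by (simp add: vec.span_singleton image_image \<Psi>_def T_simps)
  have Psi_Int: "\<Psi> ` A \<inter> \<Psi> ` B = \<Psi> ` (A \<inter> B)" for A B
    using image_Int[OF inj_Psi] by metis
  show ?thesis
  proof
    assume adm: "admissible_chi s t \<psi> \<Sigma> C chi"
    have "pspace (int s * int t - 1) chi" using adm by (simp add: admissible_chi_def)
    then have chi: "vec.subspace chi" "card chi = q ^ (s * t)"
      using pspace_iff_card[of "s * t" "int s * int t - 1" chi] card_k by auto
    obtain X where X: "chi = \<Psi> ` X" using bij_Psi by (metis bij_is_surj surj_image_vimage_eq)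
    have "\<exists>f. functional f \<and> X = chi0 f"
    proof (rule chi0_characterization)
      show "kV.subspace X" using chi X subspace_Psi_iff by simp
      show "card X = q ^ (s * t)" using chi X card_Psi by simp
      have "\<Psi> ` X \<subseteq> \<Psi> ` S0"
        using adm X Psi_S0 by (simp add: admissible_chi_def field_reduction_def)
      then show "X \<subseteq> S0" by (simp only: Psi_subset_iff)
      fix w :: "'k ^ 'n" assume "w $ i0 = 0" "w \<noteq> 0"
      then have "vec.span {T (emb \<iota> w)} \<in> points_of C" unfolding C by blast
      then have "pspace (int s - 1) (\<Psi> ` X \<inter> \<Psi> ` range (\<lambda>a. a *s emb \<iota> w))"
        using adm spanT[of w] X by (auto simp: admissible_chi_def field_reduction_def)
      then have "card (\<Psi> ` (X \<inter> range (\<lambda>a. a *s emb \<iota> w))) = q ^ s"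
        unfolding Psi_Int
        using pspace_iff_card[of s "int s - 1" "\<Psi> ` (X \<inter> range (\<lambda>a. a *s emb \<iota> w))"] card_k by simp
      then show "card (X \<inter> range (\<lambda>a. a *s emb \<iota> w)) = q ^ s" by (simp only: card_Psi)
    qed
    then show "\<exists>f. functional f \<and> chi = \<Psi> ` chi0 f" using X by blast
  next
    assume "\<exists>f. functional f \<and> chi = \<Psi> ` chi0 f"
    then obtain f where f: "functional f" "chi = \<Psi> ` chi0 f" by blast
    interpret wf: extension_functional \<iota> i0 s t q f by unfold_locales (rule f(1))
    have sub: "vec.subspace chi" using f(2) wf.subspace_chi0 subspace_Psi_iff by simp
    have "card chi = q ^ (s * t)" using f(2) card_Psi wf.card_chi0 by simp
    then have "pspace (int s * int t - 1) chi"
      using sub pspace_iff_card[of "s * t" "int s * int t - 1" chi] card_k by simp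
    moreover have "chi \<subseteq> field_reduction \<psi> \<Sigma>"
      unfolding field_reduction_def Psi_S0[symmetric] f(2) Psi_subset_iff by (rule wf.chi0_subset_S0)
    moreover have "pspace (int s - 1) (chi \<inter> field_reduction \<psi> Q)" if Q: "Q \<in> points_of C" for Q
    proof -
      obtain w where w: "Q = vec.span {T (emb \<iota> w)}" "w $ i0 = 0" "w \<noteq> 0" using Q unfolding C by blast
      have eq: "chi \<inter> field_reduction \<psi> Q = \<Psi> ` (chi0 f \<inter> range (\<lambda>a. a *s emb \<iota> w))"
        unfolding field_reduction_def w(1) spanT f(2) Psi_Int ..
      have "kV.subspace (chi0 f \<inter> range (\<lambda>a. a *s emb \<iota> w))"
        by (rule kV.subspace_inter[OF wf.subspace_chi0 subspace_line])
      then have "vec.subspace (chi \<inter> field_reduction \<psi> Q)" using eq subspace_Psi_iff by simp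
      moreover have "card (chi \<inter> field_reduction \<psi> Q) = q ^ s"
        using eq card_Psi wf.chi0_inter_line[OF w(2,3)] by simp
      ultimately show ?thesis
        using pspace_iff_card[of s "int s - 1" "chi \<inter> field_reduction \<psi> Q"] card_k by simp
    qed
    ultimately show "admissible_chi s t \<psi> \<Sigma> C chi" by (simp add: admissible_chi_def)
  qed
qed

text \<open>Some coordinate of \<open>\<Psi>\<close> does not vanish at \<open>axis i0 1\<close>.
  Restricted to the \<open>'K\<close>-line of this vector it is a nonzero \<open>'k\<close>-linear
  form.\<close>

lemma functional_exists: "\<exists>f. functional f"
proof -
  have "\<Psi> (axis i0 1) \<noteq> \<Psi> 0" using inj_Psi by (metis injD axis_eq_0_iff zero_neq_one)
  then obtain j where j: "\<Psi> (axis i0 1) $ j \<noteq> 0"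
    by (auto simp: vec_eq_iff)
  let ?f = "\<lambda>a. \<Psi> (a *s axis i0 1) $ j"
  have "functional ?f"
    unfolding functional_def
  proof (intro conjI allI)
    show "?f (a + b) = ?f a + ?f b" for a b
      by (simp add: vec.scale_left_distrib Psi_add)
    show "?f (\<iota> c * a) = c * ?f a" for c a
      using Psi_scale[of c "a *s axis i0 1"] by simp
    show "\<exists>a. ?f a \<noteq> 0" by (rule exI[of _ 1]) (simp add: j)
  qed
  then show ?thesis by (rule exI[of functional])
qed

end

section \<open>The isomorphism\<close>

locale reduction_duality_functional = reduction_duality \<iota> i0 s t q T \<Sigma> C \<psi> d + extension_functional \<iota> i0 s t q f
  for \<iota> :: "'k::{field,finite} \<Rightarrow> 'K::{field,finite}" and i0 :: "'n::finite" and s t q :: nat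
    and T :: "'K ^ 'n \<Rightarrow> 'K ^ 'n" and \<Sigma> :: "('K ^ 'n) set" and C :: "('K ^ 'n) set set"
    and \<psi> :: "'K ^ 'n \<Rightarrow> 'k ^ 'm" and d :: "('k ^ 'm) set \<Rightarrow> ('k ^ 'm) set"
    and f :: "'K \<Rightarrow> 'k"
begin

abbreviation \<phi> :: "('K ^ 'n) set \<Rightarrow> ('k ^ 'm) set" where
  "\<phi> \<equiv> phi \<psi> d (\<Psi> ` chi0 f)"

lemma phi_image: "\<phi> (T ` W) = D W \<inter> D (chi0 f)"
  by (simp add: phi_def field_reduction_def D_def \<Psi>_def image_image)

lemma D_S0: "d (field_reduction \<psi> \<Sigma>) = D S0"
  by (simp add: field_reduction_def D_def Psi_S0)

text \<open>Since \<open>chi0 f\<close> lies in \<open>S0\<close>, order reversal puts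
  \<open>D S0\<close> inside \<open>D (chi0 f)\<close>, and the intersection in \<open>phi\<close>
  leaves it unchanged.\<close>

lemma phi_hyperplane: "\<phi> \<Sigma> = D S0"
proof -
  have "D S0 \<subseteq> D (chi0 f)"
    using D_subset_iff[OF subspace_S0 subspace_chi0] chi0_subset_S0 by simp
  moreover have "\<phi> \<Sigma> = D S0 \<inter> D (chi0 f)"
    by (simp add: phi_def D_S0 D_def[of "chi0 f"])
  ultimately show ?thesis by blast
qed

lemma phi_subspace:
  assumes "vec.subspace \<tau>"
  shows "vec.subspace (\<phi> \<tau>)"
proof -
  obtain W where W: "\<tau> = T ` W" using bij by (metis bij_is_surj surj_image_vimage_eq)
  have "kV.subspace W"
  proof (rule kV.subspaceI)
    have mem: "v \<in> W \<longleftrightarrow> T v \<in> \<tau>" for v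
      unfolding W by (rule inj_image_mem_iff[OF bij_is_inj[OF bij], symmetric])
    show "0 \<in> W" using mem vec.subspace_0[OF assms] by (simp add: T_simps)
    show "x + y \<in> W" if "x \<in> W" "y \<in> W" for x y
      using that mem vec.subspace_add[OF assms] by (simp add: T_simps)
    show "\<iota> c *s x \<in> W" if "x \<in> W" for c x
      using that mem vec.subspace_scale[OF assms] by (simp add: T_simps)
  qed
  then show ?thesis
    unfolding W phi_image by (intro vec.subspace_inter subspace_D subspace_chi0)
qed

text \<open>By \<open>D_inter\<close> the image is dual to the sum of the \<open>'K\<close>-line
  with \<open>chi0 f\<close>, and this sum is \<open>xpt f x\<close>.\<close>

lemma phi_point:
  assumes "x $ i0 = 0"
  shows "\<phi> (vec.span {T (axis i0 1 + x)}) = D (xpt f x)"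
proof -
  let ?L = "range (\<lambda>a. a *s (axis i0 1 + x))"
  have "vec.span {T (axis i0 1 + x)} = T ` ?L"
    by (simp add: vec.span_singleton image_image T_simps(2)[symmetric])
  then have "\<phi> (vec.span {T (axis i0 1 + x)}) = D (ssum ?L (chi0 f))"
    by (simp only: phi_image D_inter[OF subspace_line subspace_chi0])
  moreover have "ssum ?L (chi0 f) = xpt f x"
  proof
    show "ssum ?L (chi0 f) \<subseteq> xpt f x"
      using scaled_in_xpt[OF assms] chi0_subset_xpt by (intro kV.ssum_least subspace_xpt) auto
    show "xpt f x \<subseteq> ssum ?L (chi0 f)"
    proof
      fix y assume y: "y \<in> xpt f x"
      let ?e = "y $ i0 *s (axis i0 1 + x)"
      have "y - ?e \<in> chi0 f"
        using assms by (intro xpt_diff_in_chi0[OF y scaled_in_xpt[OF assms]]) simp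
      then show "y \<in> ssum ?L (chi0 f)"
        unfolding ssum_def by (intro CollectI exI[of _ ?e] exI[of _ "y - ?e"]) simp
    qed
  qed
  ultimately show ?thesis by simp
qed

text \<open>For \<open>R = D U\<close>, the conditions dualize: \<open>U\<close> contains
  \<open>chi0 f\<close>, has vector dimension \<open>s * t + s + 1\<close>, and together with
  \<open>S0\<close> generates everything. These are the hypotheses of
  \<open>xpt_characterization\<close>.\<close>

lemma X_points_eq: "X_points t (D (chi0 f)) (D S0) = {D (xpt f x) | x. x $ i0 = 0}"
proof (intro antisym subsetI)
  fix R assume "R \<in> X_points t (D (chi0 f)) (D S0)"
  then have R: "pspace (int t - 1) R" "R \<subseteq> D (chi0 f)" "R \<inter> D S0 = {0}"
    by (auto simp: X_points_def)
  obtain U where U: "kV.subspace U" "R = D U" using R(1) D_surj by (auto simp: pspace_def)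
  have "D (ssum U S0) = D UNIV" using R(3) D_inter[OF U(1) subspace_S0] U(2) D_UNIV by simp
  then have "ssum U S0 = UNIV"
    using D_eq_iff[OF kV.subspace_ssum[OF U(1) subspace_S0] kV.subspace_UNIV] by simp
  moreover have "chi0 f \<subseteq> U" using R(2) U D_subset_iff[OF U(1) subspace_chi0] by simp
  moreover have "card U = q ^ (s * t + s + 1)"
    using R(1) U pspace_D_iff[OF U(1), of "int t - 1" "s * t + s + 1"] by simp
  ultimately obtain x where "x $ i0 = 0" "U = xpt f x"
    using xpt_characterization[OF U(1)] by (elim meta_impE exE conjE)
  then show "R \<in> {D (xpt f x) | x. x $ i0 = 0}" using U(2) by blast
next
  fix R assume "R \<in> {D (xpt f x) | x. x $ i0 = 0}"
  then obtain x where x: "R = D (xpt f x)" "x $ i0 = 0" by blast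
  have "pspace (int t - 1) R"
    using x(1) pspace_D_iff[OF subspace_xpt, of "int t - 1" "s * t + s + 1" x] card_xpt by simp
  moreover have "R \<subseteq> D (chi0 f)"
    unfolding x(1) D_subset_iff[OF subspace_xpt subspace_chi0] by (rule chi0_subset_xpt)
  moreover have "R \<inter> D S0 = {0}"
    unfolding x(1) D_inter[OF subspace_xpt subspace_S0] ssum_xpt_S0[OF x(2)] by (rule D_UNIV)
  ultimately show "R \<in> X_points t (D (chi0 f)) (D S0)" by (simp add: X_points_def)
qed

text \<open>Dualized in the same way: meeting \<open>D S0\<close> in one point means that the sum
  with \<open>S0\<close> is a \<open>'k\<close>-hyperplane, as \<open>xln_characterization\<close>
  requires.\<close>

lemma X_lines_eq: "X_lines t (D (chi0 f)) (D S0) = {D (xln f c x) | c x. c \<noteq> 0 \<and> x $ i0 = 0}"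
proof (intro antisym subsetI)
  fix M assume "M \<in> X_lines t (D (chi0 f)) (D S0)"
  then have M: "pspace (int t) M" "M \<subseteq> D (chi0 f)" "pspace 0 (M \<inter> D S0)"
    by (auto simp: X_lines_def)
  obtain Z where Z: "kV.subspace Z" "M = D Z" using M(1) D_surj by (auto simp: pspace_def)
  note ZS = kV.subspace_ssum[OF Z(1) subspace_S0]
  have "pspace 0 (D (ssum Z S0))" using M(3) D_inter[OF Z(1) subspace_S0] Z(2) by simp
  then have "card (ssum Z S0) = q ^ (s * t + s + t)"
    using pspace_D_iff[OF ZS, of 0 "s * t + s + t"] by simp
  moreover have "chi0 f \<subseteq> Z" using M(2) Z D_subset_iff[OF Z(1) subspace_chi0] by simp
  moreover have "card Z = q ^ (s * t + s)"
    using M(1) Z pspace_D_iff[OF Z(1), of "int t" "s * t + s"] by simp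
  ultimately obtain c x where "c \<noteq> 0" "x $ i0 = 0" "Z = xln f c x"
    using xln_characterization[OF Z(1)] by (elim meta_impE exE conjE)
  then show "M \<in> {D (xln f c x) | c x. c \<noteq> 0 \<and> x $ i0 = 0}" using Z(2) by blast
next
  fix M assume "M \<in> {D (xln f c x) | c x. c \<noteq> 0 \<and> x $ i0 = 0}"
  then obtain c x where x: "M = D (xln f c x)" "c \<noteq> 0" "x $ i0 = 0" by blast
  have "pspace (int t) M"
    using x pspace_D_iff[OF subspace_xln, of "int t" "s * t + s" c x] card_xln by simp
  moreover have "M \<subseteq> D (chi0 f)"
    unfolding x(1) D_subset_iff[OF subspace_xln subspace_chi0] by (rule chi0_subset_xln)
  moreover have "pspace 0 (M \<inter> D S0)"
    unfolding x(1) D_inter[OF subspace_xln subspace_S0]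
    using pspace_D_iff[OF kV.subspace_ssum[OF subspace_xln subspace_S0], of 0 "s * t + s + t" c x]
      card_ssum_xln_S0[OF x(2,3)] by simp
  ultimately show "M \<in> X_lines t (D (chi0 f)) (D S0)" by (simp add: X_lines_def)
qed

section \<open>Points, lines and incidence under the isomorphism\<close>

abbreviation "XP \<equiv> X_points t (D (chi0 f)) (D S0)"
abbreviation "XL \<equiv> X_lines t (D (chi0 f)) (D S0)"

lemma phi_bij: "bij_betw \<phi> (Y_points \<Sigma>) XP"
  unfolding bij_betw_def
proof
  show "inj_on \<phi> (Y_points \<Sigma>)"
  proof (rule inj_onI)
    fix P P' assume P: "P \<in> Y_points \<Sigma>" "P' \<in> Y_points \<Sigma>" "\<phi> P = \<phi> P'"
    obtain x where x: "P = vec.span {T (axis i0 1 + x)}" "x $ i0 = 0"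
      using P(1) unfolding Y_points_eq by blast
    obtain x' where x': "P' = vec.span {T (axis i0 1 + x')}" "x' $ i0 = 0"
      using P(2) unfolding Y_points_eq by blast
    have "D (xpt f x) = D (xpt f x')" using P(3) x x' phi_point by simp
    then have "xpt f x = xpt f x'" by (simp only: D_eq_iff[OF subspace_xpt subspace_xpt])
    then have "x = x'" by (rule inj_xpt[OF x(2) x'(2)])
    then show "P = P'" using x x' by simp
  qed
  show "\<phi> ` Y_points \<Sigma> = XP"
  proof (intro antisym subsetI)
    fix R assume "R \<in> \<phi> ` Y_points \<Sigma>"
    then obtain x where "R = \<phi> (vec.span {T (axis i0 1 + x)})" "x $ i0 = 0"
      unfolding Y_points_eq by blast
    then show "R \<in> XP" unfolding X_points_eq using phi_point by blast
  next
    fix R assume "R \<in> XP"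
    then obtain x where x: "R = D (xpt f x)" "x $ i0 = 0" unfolding X_points_eq by blast
    then have "R = \<phi> (vec.span {T (axis i0 1 + x)})" using phi_point by simp
    moreover have "vec.span {T (axis i0 1 + x)} \<in> Y_points \<Sigma>" unfolding Y_points_eq using x by blast
    ultimately show "R \<in> \<phi> ` Y_points \<Sigma>" by (rule image_eqI)
  qed
qed

text \<open>Both sides run over the coset of \<open>x\<close> modulo \<open>c\<close> times the
  rational vectors. On the side of \<open>X\<close> this is
  \<open>xln_subset_xpt_iff\<close>.\<close>

lemma phi_yline:
  assumes c: "c \<noteq> 0" and x: "x $ i0 = 0"
  shows "\<phi> ` yline c x = {R \<in> XP. R \<subseteq> D (xln f c x)}"
proof (intro antisym subsetI)
  fix R assume "R \<in> \<phi> ` yline c x"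
  then obtain w where w: "R = \<phi> (vec.span {T (axis i0 1 + x + c *s emb \<iota> w)})" "w $ i0 = 0"
    unfolding yline_def by blast
  define x' where "x' = x + c *s emb \<iota> w"
  have x': "x' $ i0 = 0" using x w(2) by (simp add: x'_def)
  have R: "R = D (xpt f x')" using w(1) phi_point[OF x'] by (simp add: x'_def add.assoc)
  have "xln f c x \<subseteq> xpt f x'"
    unfolding xln_subset_xpt_iff[OF c x x'] using w(2) x'_def by blast
  then have "R \<subseteq> D (xln f c x)" unfolding R D_subset_iff[OF subspace_xpt subspace_xln] .
  moreover have "R \<in> XP" unfolding X_points_eq using R x' by blast
  ultimately show "R \<in> {R \<in> XP. R \<subseteq> D (xln f c x)}" by blast
next
  fix R assume "R \<in> {R \<in> XP. R \<subseteq> D (xln f c x)}"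
  then have "R \<in> XP" and le: "R \<subseteq> D (xln f c x)" by blast+
  then obtain x' where x': "R = D (xpt f x')" "x' $ i0 = 0" unfolding X_points_eq by blast
  have "xln f c x \<subseteq> xpt f x'"
    using le unfolding x'(1) D_subset_iff[OF subspace_xpt subspace_xln] .
  then obtain w where w: "w $ i0 = 0" "x' = x + c *s emb \<iota> w"
    unfolding xln_subset_xpt_iff[OF c x x'(2)] by blast
  have "R = \<phi> (vec.span {T (axis i0 1 + x + c *s emb \<iota> w)})"
    using x' phi_point[OF x'(2)] w(2) by (simp add: add.assoc)
  moreover have "vec.span {T (axis i0 1 + x + c *s emb \<iota> w)} \<in> yline c x"
    unfolding yline_def using w(1) by blast
  ultimately show "R \<in> \<phi> ` yline c x" by (rule image_eqI)
qed

text \<open>By \<open>xln_eq_Inter\<close> the space dual to a line is the intersection of the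
  spaces dual to its points.\<close>

lemma X_line_determined:
  assumes M: "M \<in> XL" "M' \<in> XL" and eq: "{R \<in> XP. R \<subseteq> M} = {R \<in> XP. R \<subseteq> M'}"
  shows "M = M'"
proof -
  obtain c x where x: "M = D (xln f c x)" "c \<noteq> 0" "x $ i0 = 0" using M(1) unfolding X_lines_eq by blast
  obtain c' x' where x': "M' = D (xln f c' x')" "c' \<noteq> 0" "x' $ i0 = 0" using M(2) unfolding X_lines_eq by blast
  have iff: "xln f c x \<subseteq> xpt f z \<longleftrightarrow> xln f c' x' \<subseteq> xpt f z" if z: "z $ i0 = 0" for z
  proof -
    have "D (xpt f z) \<in> XP" unfolding X_points_eq using z by blast
    then have "D (xpt f z) \<subseteq> M \<longleftrightarrow> D (xpt f z) \<subseteq> M'" using eq by blast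
    then show ?thesis unfolding x(1) x'(1) D_subset_iff[OF subspace_xpt subspace_xln] .
  qed
  have "{xpt f z | z. z $ i0 = 0 \<and> xln f c x \<subseteq> xpt f z} = {xpt f z | z. z $ i0 = 0 \<and> xln f c' x' \<subseteq> xpt f z}"
    using iff by metis
  then have "xln f c x = xln f c' x'"
    using xln_eq_Inter[OF x(2,3)] xln_eq_Inter[OF x'(2,3)] by simp
  then show ?thesis using x(1) x'(1) by simp
qed

lemma line_image: "L \<in> Y_lines \<iota> t C \<Longrightarrow> \<exists>M\<in>XL. \<phi> ` L = {R \<in> XP. R \<subseteq> M}"
proof -
  assume "L \<in> Y_lines \<iota> t C"
  then obtain c x where x: "L = yline c x" "c \<noteq> 0" "x $ i0 = 0" unfolding Y_lines_eq by blast
  show ?thesis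
  proof (rule bexI)
    show "\<phi> ` L = {R \<in> XP. R \<subseteq> D (xln f c x)}" unfolding x(1) by (rule phi_yline[OF x(2,3)])
    show "D (xln f c x) \<in> XL" unfolding X_lines_eq using x by blast
  qed
qed

lemma phi_geometry_iso: "geometry_iso \<phi> (Y_points \<Sigma>) (Y_lines \<iota> t C) (\<in>) XP XL (\<subseteq>)"
proof (rule geometry_isoI[OF phi_bij _ line_image _ X_line_determined])
  fix L assume "L \<in> Y_lines \<iota> t C"
  then obtain c x where x: "L = yline c x" "x $ i0 = 0" unfolding Y_lines_eq by blast
  show "L \<subseteq> Y_points \<Sigma>"
  proof
    fix P assume "P \<in> L"
    then obtain w where w: "P = vec.span {T (axis i0 1 + x + c *s emb \<iota> w)}" "w $ i0 = 0"
      unfolding x(1) yline_def by blast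
    have "(x + c *s emb \<iota> w) $ i0 = 0" using w(2) x(2) by simp
    then show "P \<in> Y_points \<Sigma>"
      unfolding Y_points_eq using w(1) by (intro CollectI exI[of _ "x + c *s emb \<iota> w"]) (simp add: add.assoc)
  qed
next
  fix M assume "M \<in> XL"
  then obtain c x where x: "M = D (xln f c x)" "c \<noteq> 0" "x $ i0 = 0" unfolding X_lines_eq by blast
  show "\<exists>L\<in>Y_lines \<iota> t C. \<phi> ` L = {R \<in> XP. R \<subseteq> M}"
  proof (rule bexI)
    show "\<phi> ` yline c x = {R \<in> XP. R \<subseteq> M}" unfolding x(1) by (rule phi_yline[OF x(2,3)])
    show "yline c x \<in> Y_lines \<iota> t C" by (rule yline_is_line[OF x(2,3)])
  qed
qed

lemma pspace_D_chi0: "pspace (int s + int t) (D (chi0 f))"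
  using pspace_D_iff[OF subspace_chi0, of "int s + int t" "s * t"] card_chi0 by simp

lemma pspace_D_S0: "pspace (int s) (D S0)"
  using pspace_D_iff[OF subspace_S0, of "int s" "(s + 1) * t"] card_S0 by (simp add: algebra_simps)

end

theorem theorem4p2:
  fixes s t q :: nat
    and \<iota> :: "'k::{field,finite} \<Rightarrow> 'K::{field,finite}"
    and \<psi> :: "'K ^ 'n \<Rightarrow> 'k ^ 'm"
    and \<Sigma> :: "('K ^ 'n) set"
    and C :: "('K ^ 'n) set set"
    and d :: "('k ^ 'm) set \<Rightarrow> ('k ^ 'm) set"
  assumes "t \<noteq> 0"
    and "CARD('k) = q" and "CARD('K) = q ^ (s + 1)"
    and "CARD('n) = t + 1" and "CARD('m) = (s + 1) * (t + 1)"
    and "field_embedding \<iota>"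
    and "linear_iso_over \<iota> \<psi>"
    and "pspace (int t - 1) \<Sigma>"
    and "subgeometry \<iota> (int t - 1) C" and "\<forall>U\<in>C. U \<subseteq> \<Sigma>"
    and "duality (int s * int t + int s + int t) d"
  shows "(\<exists>chi. admissible_chi s t \<psi> \<Sigma> C chi) \<and>
    (\<forall>chi \<pi>. admissible_chi s t \<psi> \<Sigma> C chi \<and> \<pi> = phi \<psi> d chi \<Sigma> \<longrightarrow>
       pspace (int s + int t) (d chi) \<and>
       (\<forall>\<tau>. vec.subspace \<tau> \<longrightarrow> vec.subspace (phi \<psi> d chi \<tau>) \<and> phi \<psi> d chi \<tau> \<subseteq> d chi) \<and>
       \<pi> = d (field_reduction \<psi> \<Sigma>) \<and>
       pspace (int s) \<pi> \<and>
       geometry_iso (phi \<psi> d chi)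
         (Y_points \<Sigma>) (Y_lines \<iota> t C) (\<in>)
         (X_points t (d chi) \<pi>) (X_lines t (d chi) \<pi>) (\<subseteq>) \<and>
       (\<forall>L\<in>Y_lines \<iota> t C. \<exists>M\<in>X_lines t (d chi) \<pi>.
          phi \<psi> d chi ` L = {R \<in> X_points t (d chi) \<pi>. R \<subseteq> M}))"
proof -
  interpret e: field_emb \<iota> by unfold_locales (rule assms(6))
  \<comment> \<open>Any coordinate may play the role of the one that vanishes on
    \<open>\<Sigma>\<close> after the change of basis.\<close>
  fix i0 :: 'n
  obtain T where T: "Vector_Spaces.linear (*s) (*s) T" "bij T" "T ` {x. x $ i0 = 0} = \<Sigma>"
    "points_of C = {vec.span {T (emb \<iota> w)} | w. w $ i0 = 0 \<and> w \<noteq> 0}"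
    using e.subgeometry_of_hyperplane_coords[OF assms(4,8,9,10), of i0] by (elim exE conjE) (rule that)
  interpret ds: reduction_duality \<iota> i0 s t q T \<Sigma> C \<psi> d
    by unfold_locales (use assms T in \<open>simp_all add: vec.linear_add[OF T(1)] vec.linear_scale[OF T(1)]\<close>)
  show ?thesis
  proof (intro conjI allI impI)
    obtain f where "ds.functional f" using ds.functional_exists by (elim exE)
    then show "\<exists>chi. admissible_chi s t \<psi> \<Sigma> C chi"
      using ds.admissible_chi_iff by blast
  next
    fix chi \<pi> assume adm: "admissible_chi s t \<psi> \<Sigma> C chi \<and> \<pi> = phi \<psi> d chi \<Sigma>"
    then obtain f where f: "ds.functional f" "chi = ds.\<Psi> ` ds.chi0 f"
      using ds.admissible_chi_iff by blast
    interpret reduction_duality_functional \<iota> i0 s t q T \<Sigma> C \<psi> d f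
      by unfold_locales (rule f(1))
    have dchi: "d chi = ds.D (ds.chi0 f)" by (simp add: f(2) ds.D_def)
    have \<pi>: "\<pi> = ds.D ds.S0" using adm phi_hyperplane f(2) by simp
    show "pspace (int s + int t) (d chi)" unfolding dchi by (rule pspace_D_chi0)
    show "pspace (int s) \<pi>" unfolding \<pi> by (rule pspace_D_S0)
    show "\<pi> = d (field_reduction \<psi> \<Sigma>)" unfolding \<pi> D_S0 ..
    show "vec.subspace (phi \<psi> d chi \<tau>)" if "vec.subspace \<tau>" for \<tau>
      unfolding f(2) by (rule phi_subspace[OF that])
    show "phi \<psi> d chi \<tau> \<subseteq> d chi" for \<tau> by (simp add: phi_def)
    show "geometry_iso (phi \<psi> d chi) (Y_points \<Sigma>) (Y_lines \<iota> t C) (\<in>)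
        (X_points t (d chi) \<pi>) (X_lines t (d chi) \<pi>) (\<subseteq>)"
      unfolding dchi \<pi> f(2)[symmetric] using phi_geometry_iso f(2) by simp
    show "\<forall>L\<in>Y_lines \<iota> t C. \<exists>M\<in>X_lines t (d chi) \<pi>.
        phi \<psi> d chi ` L = {R \<in> X_points t (d chi) \<pi>. R \<subseteq> M}"
      unfolding dchi \<pi> using line_image f(2) by simp
  qed
qed

end
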